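(* Let $L\geq1$ be an integer and let $\{u_k\}_{k=0}^{N-1}$ be an input sequence with $u_k\in\mathbb{R}^m$. (i) If $\{u_k\}_{k=0}^{N-1}$ is persistently exciting of order $L+n$, then, for any controllable system $\Sigma\in\bm{\Sigma}_{n,m,p}^{\mathrm{c}}$ and any $x_0\in\mathbb{R}^n$, $$\mathrm{im}\begin{bmatrix} H_L(u) \\ H_L(y(\Sigma,x_0,u)) \end{bmatrix}=\left\{\begin{bmatrix} \bar u \\ \bar y(\Sigma,\bar x_0,\bar u) \end{bmatrix}\ \middle|\ \bar u\in\mathbb{R}^{mL},\ \bar x_0\in\mathbb{R}^n\right\}.$$ (ii) If $\{u_k\}_{k=0}^{N-1}$ is $K_{\mathrm u}$-persistently exciting of order $L+n$ for some $K_{\mathrm u}\succ0$, then, for any $\Sigma\in\bm{\Sigma}_{n,m,p}^{\mathrm{c}}$ and any $x_0\in\mathbb{R}^n$, $$\begin{bmatrix} H_1(x_{[0,N-L]}) \\ H_L(u) \end{bmatrix}\begin{bmatrix} H_1(x_{[0,N-L]}) \\ H_L(u) \end{bmatrix}^\top\succeq\frac{1}{n+1}ZK_{\mathrm u}Z^\top,$$ where $\{x_k\}$ is the state sequence of $\Sigma$ generated by the input $u$ from the initial condition $x_0$, and $Z$ is the matrix associated with $\Sigma$ and $L$ as in the context.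
   Context: All matrices are real; $\succ,\succeq$ denote the positive definite / semidefinite ordering of symmetric matrices; $\mathrm{im}$ is the image (column space) and $\otimes$ the Kronecker product. System: $\Sigma=(A,B,C,D)$ with $A\in\mathbb{R}^{n\times n}$, $B\in\mathbb{R}^{n\times m}$, $C\in\mathbb{R}^{p\times n}$, $D\in\mathbb{R}^{p\times m}$ denotes the discrete-time linear time-invariant system $x_{k+1}=Ax_k+Bu_k$, $y_k=Cx_k+Du_k$. $\bm{\Sigma}_{n,m,p}^{\mathrm{c}}$ denotes the set of all such systems with $(A,B)$ controllable. $y(\Sigma,x_0,u)=\{y_k(\Sigma,x_0,u)\}_{k=0}^{N-1}$ denotes the output sequence generated by applying $\{u_k\}_{k=0}^{N-1}$ to $\Sigma$ with initial condition $x_0$; likewise, for $\bar u\in\mathbb{R}^{mL}$ regarded as a stacked input sequence of length $L$, $\bar y(\Sigma,\bar x_0,\bar u)\in\mathbb{R}^{pL}$ is the stacked output sequence of length $L$ generated from the initial condition $\bar x_0$. Windows and Hankel matrix: $w_{[a,b]}=\begin{bmatrix}w_a^\top&\dots&w_b^\top\end{bmatrix}^\top$; for $\{w_k\}_{k=0}^{N-1}$ with $w_k\in\mathbb{R}^q$, $H_L(w)\in\mathbb{R}^{qL\times(N-L+1)}$ is the block Hankel matrix whose columns are $w_{[k,k+L-1]}$, $k=0,\dots,N-L$. In particular $H_1(x_{[0,N-L]})=\begin{bmatrix}x_0&x_1&\dots&x_{N-L}\end{bmatrix}$. Persistence of excitation: $\{w_k\}_{k=0}^{N-1}$ with $w_k\in\mathbb{R}^q$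 is persistently exciting (PE) of order $\ell$ if $\mathrm{rank}(H_\ell(w))=q\ell$. It is $K$-persistently exciting ($K$-PE) of order $\ell$, for a symmetric matrix $K\succ0$, if $H_\ell(w)H_\ell(w)^\top=\sum_{k=0}^{N-\ell}w_{[k,k+\ell-1]}w_{[k,k+\ell-1]}^\top\succeq K$. The matrix $Z$: for a given $\Sigma=(A,B,C,D)$, fix a polynomial $d(z)=\sum_{j=0}^n d_jz^{n-j}$ with real coefficients, $d_0\neq0$ and $d(A)=0$ (it exists by Cayley-Hamilton), with $d=\begin{bmatrix}d_n&\cdots&d_1&d_0\end{bmatrix}^\top\in\mathbb{R}^{n+1}$ normalized so that $\lVert d\rVert_2=1$. Consider the system with the same state equation and extended output $\phi_k=\begin{bmatrix} x_k \\ u_k \end{bmatrix}=\tilde Cx_k+\tilde Du_k\in\mathbb{R}^{n+m}$, where $\tilde C=\begin{bmatrix} I_n \\ 0 \end{bmatrix}$, $\tilde D=\begin{bmatrix} 0 \\ I_m \end{bmatrix}$. Its Markov parameters are $\Gamma_0=\tilde D$, $\Gamma_i=\tilde CA^{i-1}B$ for $i=1,\dots,n$. Set $M=\begin{bmatrix}M_n&\dots&M_1&M_0\end{bmatrix}\in\mathbb{R}^{(n+m)\times m(n+1)}$ with $M_j=\sum_{q=0}^{j}d_{j-q}\Gamma_q$. Let $T\in\mathbb{R}^{(L-1)\times(L+n-1)}$ be the banded Toeplitz matrix whose $i$-th row ($i=1,\dots,L-1$) has the entries $d_n,d_{n-1},\dots,d_0$ in columns $i,i+1,\dots,i+n$ and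 zeros elsewhere. Then $$Z=\begin{bmatrix} M & 0_{(m+n)\times m(L-1)} \\ 0_{m(L-1)\times m} & T\otimes I_m \end{bmatrix}\in\mathbb{R}^{(n+mL)\times m(L+n)},$$ where the two block rows are partitioned independently: the first has column blocks of widths $m(n+1)$ and $m(L-1)$, the second of widths $m$ and $m(L+n-1)$. For $L=1$, $Z=M$. *)

theory Defs
  imports Complex_Main "Jordan_Normal_Form.DL_Rank"
begin

text \<open>
  All sizes are natural numbers carried by the predicates \<open>carrier_mat\<close> / \<open>carrier_vec\<close>.
  A finite signal \<open>{w_k}\<close>, \<open>k = 0, \<dots>, N - 1\<close>, is a function on the naturals together with its
  length \<open>N\<close>; its values from index \<open>N\<close> on are never constrained and never used.
\<close>

section \<open>Symmetric matrices\<close>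

definition symmetric_real_mat :: "nat \<Rightarrow> real mat \<Rightarrow> bool" where
  "symmetric_real_mat n X \<longleftrightarrow> X \<in> carrier_mat n n \<and> X\<^sup>T = X"

definition pos_def :: "nat \<Rightarrow> real mat \<Rightarrow> bool" where
  "pos_def n X \<longleftrightarrow> symmetric_real_mat n X \<and>
     (\<forall>v \<in> carrier_vec n. v \<noteq> 0\<^sub>v n \<longrightarrow> 0 < v \<bullet> (X *\<^sub>v v))"

definition pos_semidef :: "nat \<Rightarrow> real mat \<Rightarrow> bool" where
  "pos_semidef n X \<longleftrightarrow> symmetric_real_mat n X \<and>
     (\<forall>v \<in> carrier_vec n. 0 \<le> v \<bullet> (X *\<^sub>v v))"

definition loewner_ge :: "nat \<Rightarrow> real mat \<Rightarrow> real mat \<Rightarrow> bool" where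
  "loewner_ge n X Y \<longleftrightarrow>
     symmetric_real_mat n X \<and> symmetric_real_mat n Y \<and> pos_semidef n (X - Y)"

section \<open>Matrix operations missing from the library\<close>

definition append_cols :: "real mat \<Rightarrow> real mat \<Rightarrow> real mat" where
  "append_cols X Y = four_block_mat X Y (0\<^sub>m 0 (dim_col X)) (0\<^sub>m 0 (dim_col Y))"

definition kronecker :: "real mat \<Rightarrow> real mat \<Rightarrow> real mat" where
  "kronecker X Y = mat (dim_row X * dim_row Y) (dim_col X * dim_col Y)
     (\<lambda>(i, j). X $$ (i div dim_row Y, j div dim_col Y) * Y $$ (i mod dim_row Y, j mod dim_col Y))"

text \<open>The matrix \<open>\<Sum>k\<in>I. c k \<cdot> X k\<close> of size \<open>nr \<times> nc\<close>; type \<open>mat\<close> has no zero of unspecified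
  size, hence the explicit dimensions.\<close>

definition mat_lincomb ::
    "nat \<Rightarrow> nat \<Rightarrow> nat set \<Rightarrow> (nat \<Rightarrow> real) \<Rightarrow> (nat \<Rightarrow> real mat) \<Rightarrow> real mat" where
  "mat_lincomb nr nc I c X = mat nr nc (\<lambda>ij. \<Sum>k\<in>I. c k * X k $$ ij)"

section \<open>Windows, Hankel matrices, persistence of excitation\<close>

text \<open>\<open>window q w a b\<close> is the stacked vector of \<open>w_a, \<dots>, w_b\<close>, each in \<open>\<real>\<^sup>q\<close>; \<open>unstack q v\<close> reads
  a stacked vector as a sequence of blocks in \<open>\<real>\<^sup>q\<close>.\<close>

definition window :: "nat \<Rightarrow> (nat \<Rightarrow> real vec) \<Rightarrow> nat \<Rightarrow> nat \<Rightarrow> real vec" where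
  "window q w a b = vec (q * (b + 1 - a)) (\<lambda>i. w (a + i div q) $ (i mod q))"

definition unstack :: "nat \<Rightarrow> real vec \<Rightarrow> nat \<Rightarrow> real vec" where
  "unstack q v k = vec q (\<lambda>i. v $ (k * q + i))"

text \<open>The number of columns is \<open>N + 1 - L\<close> (truncated), so that there are none if \<open>N < L\<close>.\<close>

definition hankel :: "nat \<Rightarrow> nat \<Rightarrow> nat \<Rightarrow> (nat \<Rightarrow> real vec) \<Rightarrow> real mat" where
  "hankel q L N w = mat_of_cols (q * L) (map (\<lambda>k. window q w k (k + L - 1)) [0 ..< N + 1 - L])"

definition persistently_exciting :: "nat \<Rightarrow> nat \<Rightarrow> nat \<Rightarrow> (nat \<Rightarrow> real vec) \<Rightarrow> bool" where
  "persistently_exciting q l N w \<longleftrightarrow> vec_space.rank (q * l) (hankel q l N w) = q * l"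

definition K_persistently_exciting ::
    "real mat \<Rightarrow> nat \<Rightarrow> nat \<Rightarrow> nat \<Rightarrow> (nat \<Rightarrow> real vec) \<Rightarrow> bool" where
  "K_persistently_exciting K q l N w \<longleftrightarrow>
     pos_def (q * l) K \<and> loewner_ge (q * l) (hankel q l N w * (hankel q l N w)\<^sup>T) K"

section \<open>Linear systems\<close>

primrec sys_state :: "real mat \<Rightarrow> real mat \<Rightarrow> real vec \<Rightarrow> (nat \<Rightarrow> real vec) \<Rightarrow> nat \<Rightarrow> real vec" where
  "sys_state A B x0 u 0 = x0"
| "sys_state A B x0 u (Suc k) = A *\<^sub>v sys_state A B x0 u k + B *\<^sub>v u k"

definition sys_output :: "real mat \<times> real mat \<times> real mat \<times> real mat \<Rightarrow>
    real vec \<Rightarrow> (nat \<Rightarrow> real vec) \<Rightarrow> nat \<Rightarrow> real vec" where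
  "sys_output S x0 u k = (case S of (A, B, C, D) \<Rightarrow> C *\<^sub>v sys_state A B x0 u k + D *\<^sub>v u k)"

text \<open>\<open>(A, B)\<close> is controllable: every state can be steered to every state in finite time.\<close>

definition controllable :: "nat \<Rightarrow> nat \<Rightarrow> real mat \<Rightarrow> real mat \<Rightarrow> bool" where
  "controllable n m A B \<longleftrightarrow>
     (\<forall>x0 \<in> carrier_vec n. \<forall>x1 \<in> carrier_vec n.
        \<exists>u T. (\<forall>k. u k \<in> carrier_vec m) \<and> sys_state A B x0 u T = x1)"

definition controllable_systems ::
    "nat \<Rightarrow> nat \<Rightarrow> nat \<Rightarrow> (real mat \<times> real mat \<times> real mat \<times> real mat) set" where
  "controllable_systems n m p =
     {(A, B, C, D). A \<in> carrier_mat n n \<and> B \<in> carrier_mat n m \<and>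
        C \<in> carrier_mat p n \<and> D \<in> carrier_mat p m \<and> controllable n m A B}"

section \<open>The matrix Z\<close>

text \<open>\<open>d 0, \<dots>, d n\<close> are the coefficients of \<open>d(z) = \<Sum>j\<le>n. d j * z ^ (n - j)\<close>, so \<open>d 0\<close> is the
  leading one; they satisfy \<open>d(A) = 0\<close> and are normalized to Euclidean norm 1.\<close>

definition annihilating_coeffs :: "nat \<Rightarrow> real mat \<Rightarrow> (nat \<Rightarrow> real) \<Rightarrow> bool" where
  "annihilating_coeffs n A d \<longleftrightarrow>
     d 0 \<noteq> 0 \<and> mat_lincomb n n {0..n} d (\<lambda>j. A ^\<^sub>m (n - j)) = 0\<^sub>m n n \<and>
     sqrt (\<Sum>j = 0..n. (d j)\<^sup>2) = 1"

definition C_ext :: "nat \<Rightarrow> nat \<Rightarrow> real mat" where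
  "C_ext n m = 1\<^sub>m n @\<^sub>r 0\<^sub>m m n"

definition D_ext :: "nat \<Rightarrow> nat \<Rightarrow> real mat" where
  "D_ext n m = 0\<^sub>m n m @\<^sub>r 1\<^sub>m m"

definition markov_ext :: "nat \<Rightarrow> nat \<Rightarrow> real mat \<Rightarrow> real mat \<Rightarrow> nat \<Rightarrow> real mat" where
  "markov_ext n m A B i = (if i = 0 then D_ext n m else C_ext n m * A ^\<^sub>m (i - 1) * B)"

definition M_block ::
    "nat \<Rightarrow> nat \<Rightarrow> real mat \<Rightarrow> real mat \<Rightarrow> (nat \<Rightarrow> real) \<Rightarrow> nat \<Rightarrow> real mat" where
  "M_block n m A B d j = mat_lincomb (n + m) m {0..j} (\<lambda>q. d (j - q)) (markov_ext n m A B)"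

text \<open>The block row \<open>[M_n \<dots> M_1 M_0]\<close>.\<close>

definition M_mat :: "nat \<Rightarrow> nat \<Rightarrow> real mat \<Rightarrow> real mat \<Rightarrow> (nat \<Rightarrow> real) \<Rightarrow> real mat" where
  "M_mat n m A B d = mat (n + m) (m * (n + 1))
     (\<lambda>(i, c). M_block n m A B d (n - c div m) $$ (i, c mod m))"

text \<open>With 0-based indices, row \<open>i\<close> carries \<open>d n, \<dots>, d 0\<close> in columns \<open>i, \<dots>, i + n\<close>.\<close>

definition T_mat :: "nat \<Rightarrow> nat \<Rightarrow> (nat \<Rightarrow> real) \<Rightarrow> real mat" where
  "T_mat n L d = mat (L - 1) (L + n - 1)
     (\<lambda>(i, c). if i \<le> c \<and> c \<le> i + n then d (n - (c - i)) else 0)"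

definition Z_mat ::
    "nat \<Rightarrow> nat \<Rightarrow> nat \<Rightarrow> real mat \<Rightarrow> real mat \<Rightarrow> (nat \<Rightarrow> real) \<Rightarrow> real mat" where
  "Z_mat n m L A B d =
     append_cols (M_mat n m A B d) (0\<^sub>m (m + n) (m * (L - 1))) @\<^sub>r
     append_cols (0\<^sub>m (m * (L - 1)) m) (kronecker (T_mat n L d) (1\<^sub>m m))"

end

theory Submission
  imports Defs
begin

text \<open>
  Linear combinations of time-shifted data windows are again trajectories, and persistency of
  excitation of order \<open>L + n\<close> makes every input of length \<open>L + n\<close> arise in this way. Let
  \<open>(\<xi>, \<eta>)\<close> annihilate all columns \<open>(x\<^sub>k, u\<^bsub>[k,k+L-1]\<^esub>)\<close>, and let \<open>f k\<close> be the value of this functional at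
  time \<open>k\<close> along an arbitrary trajectory. A linear dependence \<open>a\<close> between the \<open>n + 1\<close> row vectors
  \<open>\<xi> A\<^sup>j\<close> cancels the contribution of the initial state, so \<open>f\<close> obeys the recurrence
  \<open>\<Sum>\<^sub>j a j * f (k + j) = 0\<close>. Hence \<open>f\<close> vanishes along every trajectory that rests at the origin
  long enough, and by controllability \<open>\<xi> = 0\<close> and \<open>\<eta> = 0\<close>. So initial state and input of any trajectory
  of length \<open>L\<close> can be matched by combining data windows, which gives (i).

  For (ii), \<open>Z\<close> applied to a window of \<open>u\<close> of length \<open>L + n\<close> is the combination with
  coefficients \<open>d\<close> of \<open>n + 1\<close> successive columns \<open>(x\<^sub>k, u\<^bsub>[k,k+L-1]\<^esub>)\<close>, because \<open>d(A) = 0\<close>. Cauchy-Schwarz with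
  \<open>\<parallel>d\<parallel> = 1\<close> then bounds the quadratic form of \<open>Z K Z\<^sup>T\<close>, each column being counted at most
  \<open>n + 1\<close> times.
\<close>

subsection \<open>Surjectivity and linear dependence\<close>

text \<open>A maximal independent set of columns has as many elements as the rank, here
  \<open>r\<close>. It is therefore a basis, so the column space is everything.\<close>

lemma full_rank_surj:
  fixes A :: "real mat"
  assumes A: "A \<in> carrier_mat r c" and rank: "vec_space.rank r A = r"
    and y: "y \<in> carrier_vec r"
  shows "\<exists>g \<in> carrier_vec c. A *\<^sub>v g = y"
proof -
  interpret V: vec_space "TYPE(real)" r .
  have cols: "set (cols A) \<subseteq> carrier_vec r" using A cols_dim by blast
  obtain S where S: "finite S" "maximal S (\<lambda>T. T \<subseteq> set (cols A) \<and> V.lin_indpt T)"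
    using maximal_exists_superset[of "set (cols A)" "\<lambda>T. T \<subseteq> set (cols A) \<and> V.lin_indpt T" "{}"]
    by (auto simp: V.lin_dep_def)
  hence sub: "S \<subseteq> set (cols A)" and li: "V.lin_indpt S" unfolding maximal_def by auto
  have "card S = r" using V.rank_card_indpt[OF A S(2)] rank by simp
  hence "V.basis S" using S sub li cols by (intro V.dim_li_is_basis) (auto simp: V.dim_is_n)
  hence "V.span S = carrier_vec r" unfolding V.basis_def by auto
  hence "carrier_vec r \<subseteq> V.span (set (cols A))" using V.span_is_monotone[OF sub] by simp
  hence "y \<in> V.col_space A" using y unfolding V.col_space_def by auto
  thus ?thesis unfolding V.col_space_eq[OF A] using A by auto
qed

lemma scalar_prod_self_eq_0_iff:
  fixes v :: "real vec"
  assumes "v \<in> carrier_vec r"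
  shows "v \<bullet> v = 0 \<longleftrightarrow> v = 0\<^sub>v r"
proof
  assume "v \<bullet> v = 0"
  hence "\<forall>i<r. v $ i = 0"
    using assms by (auto simp: scalar_prod_def sum_nonneg_eq_0_iff)
  thus "v = 0\<^sub>v r" using assms by (intro eq_vecI) auto
qed (use assms in auto)

lemma scalar_prod_self_nonneg: "0 \<le> v \<bullet> (v :: real vec)"
  by (auto simp: scalar_prod_def intro: sum_nonneg)

text \<open>The Gram matrix \<open>G * G\<^sup>T\<close> is injective: if it kills \<open>w\<close>,
  then \<open>G\<^sup>T *\<^sub>v w\<close> has norm zero, so \<open>w\<close> is orthogonal to all
  columns of \<open>G\<close>. Being square, it is then invertible, and a solution of
  \<open>G *\<^sub>v g = y\<close> is found in the image of \<open>G\<^sup>T\<close>.\<close>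

lemma trivial_left_kernel_surj:
  fixes G :: "real mat"
  assumes G: "G \<in> carrier_mat r c"
    and ker: "\<And>v. v \<in> carrier_vec r \<Longrightarrow> (\<And>k. k < c \<Longrightarrow> v \<bullet> col G k = 0) \<Longrightarrow> v = 0\<^sub>v r"
    and y: "y \<in> carrier_vec r"
  shows "\<exists>g \<in> carrier_vec c. G *\<^sub>v g = y"
proof -
  have GG: "G * G\<^sup>T \<in> carrier_mat r r" using G by auto
  have "w = 0\<^sub>v r" if w: "w \<in> carrier_vec r" and 0: "(G * G\<^sup>T) *\<^sub>v w = 0\<^sub>v r" for w
  proof (rule ker[OF w])
    have "(G\<^sup>T *\<^sub>v w) \<bullet> (G\<^sup>T *\<^sub>v w) = w \<bullet> (G *\<^sub>v (G\<^sup>T *\<^sub>v w))"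
      using G w by (intro transpose_vec_mult_scalar[OF G]) auto
    also have "\<dots> = w \<bullet> ((G * G\<^sup>T) *\<^sub>v w)"
      by (subst assoc_mult_mat_vec[OF G _ w]) (use G in auto)
    also have "\<dots> = 0" using 0 w by simp
    finally have "G\<^sup>T *\<^sub>v w = 0\<^sub>v c"
      using scalar_prod_self_eq_0_iff[of "G\<^sup>T *\<^sub>v w" c] G w by auto
    moreover fix k assume k: "k < c"
    ultimately have "(G\<^sup>T *\<^sub>v w) $ k = 0" by simp
    thus "w \<bullet> col G k = 0"
      using k G w by (auto simp: comm_scalar_prod[of w r])
  qed
  hence "det (G * G\<^sup>T) \<noteq> 0" using det_0_iff_vec_prod_zero_field[OF GG] by blast
  hence "vec_space.rank r (G * G\<^sup>T) = r" by (rule vec_space.low_rank_det_zero[OF GG])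
  then obtain g where g: "g \<in> carrier_vec r" "(G * G\<^sup>T) *\<^sub>v g = y"
    using full_rank_surj[OF GG _ y] by auto
  show ?thesis
  proof (rule bexI)
    show "G *\<^sub>v (G\<^sup>T *\<^sub>v g) = y"
      using assoc_mult_mat_vec[OF G _ g(1), of "G\<^sup>T"] g(2) G by simp
    show "G\<^sup>T *\<^sub>v g \<in> carrier_vec c" using G g by simp
  qed
qed

text \<open>The \<open>n + 1\<close> vectors \<open>(A ^\<^sub>m j)\<^sup>T *\<^sub>v \<xi>\<close>
  live in dimension \<open>n\<close>, hence are linearly dependent. The coefficients
  \<open>a\<close> give a filter along which the free response is invisible to the functional
  \<open>\<xi>\<close>.\<close>

lemma krylov_dependent:
  fixes A :: "real mat"
  assumes A: "A \<in> carrier_mat n n" and \<xi>: "\<xi> \<in> carrier_vec n"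
  obtains a :: "nat \<Rightarrow> real" and j where "j \<le> n" "a j \<noteq> 0"
    "\<And>x. x \<in> carrier_vec n \<Longrightarrow> (\<Sum>j\<le>n. a j * (\<xi> \<bullet> (A ^\<^sub>m j *\<^sub>v x))) = 0"
proof -
  define y where "y j = (A ^\<^sub>m j)\<^sup>T *\<^sub>v \<xi>" for j
  have y: "y j \<in> carrier_vec n" for j using A by (auto simp: y_def intro!: carrier_vecI)
  \<comment> \<open>Column \<open>j\<close> of \<open>P\<close> is \<open>y j\<close>, completed by
    a zero entry in the last row. The zero row makes \<open>P\<close> square and singular, so a
    dependence between its columns comes from the determinant criterion.\<close>
  define P where "P = mat\<^sub>r (Suc n) (Suc n) (\<lambda>i. if i = n then 0\<^sub>v (Suc n) else vec (Suc n) (\<lambda>j. y j $ i))"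
  have P: "P \<in> carrier_mat (Suc n) (Suc n)" by (simp add: P_def)
  have "det P = 0" unfolding P_def by (rule det_row_0) auto
  then obtain v where v: "v \<in> carrier_vec (Suc n)" "v \<noteq> 0\<^sub>v (Suc n)" "P *\<^sub>v v = 0\<^sub>v (Suc n)"
    using det_0_iff_vec_prod_zero_field[OF P] by blast
  have "\<exists>j<Suc n. v $ j \<noteq> 0"
  proof (rule ccontr)
    assume "\<not> ?thesis"
    hence "v = 0\<^sub>v (Suc n)" using v(1) by (intro eq_vecI) auto
    thus False using v(2) by simp
  qed
  then obtain j where j: "j \<le> n" "v $ j \<noteq> 0" using less_Suc_eq_le by blast
  have comb: "(\<Sum>j\<le>n. v $ j * y j $ i) = 0" if "i < n" for i
  proof -
    have "P $$ (i, j) = y j $ i" if "j < Suc n" for j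
      using that \<open>i < n\<close> by (simp add: P_def)
    hence "(\<Sum>j\<le>n. v $ j * y j $ i) = (P *\<^sub>v v) $ i"
      using that v(1) P
      by (simp add: scalar_prod_def lessThan_Suc_atMost[symmetric] atLeast0LessThan mult.commute
          del: sum.lessThan_Suc)
    thus ?thesis using v(3) that by simp
  qed
  have "(\<Sum>j\<le>n. v $ j * (\<xi> \<bullet> (A ^\<^sub>m j *\<^sub>v x))) = 0" if x: "x \<in> carrier_vec n" for x
  proof -
    have "\<xi> \<bullet> (A ^\<^sub>m j *\<^sub>v x) = y j \<bullet> x" for j
      unfolding y_def using A x \<xi> by (intro transpose_vec_mult_scalar[symmetric]) auto
    hence "(\<Sum>j\<le>n. v $ j * (\<xi> \<bullet> (A ^\<^sub>m j *\<^sub>v x))) = (\<Sum>j\<le>n. \<Sum>i<n. v $ j * (y j $ i * x $ i))"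
      using x by (simp add: scalar_prod_def sum_distrib_left atLeast0LessThan)
    also have "\<dots> = (\<Sum>i<n. (\<Sum>j\<le>n. v $ j * y j $ i) * x $ i)"
      by (subst sum.swap) (simp add: sum_distrib_right mult.assoc)
    also have "\<dots> = 0" by (simp add: comb)
    finally show ?thesis .
  qed
  with that j show thesis by blast
qed

subsection \<open>Linear combinations of shifted signals\<close>

text \<open>Row block \<open>i\<close> of a Hankel matrix with \<open>c\<close> columns, applied to \<open>g\<close>. As a function of \<open>i\<close> it is again a signal.\<close>

definition lcomb :: "nat \<Rightarrow> nat \<Rightarrow> real vec \<Rightarrow> (nat \<Rightarrow> real vec) \<Rightarrow> nat \<Rightarrow> real vec" where
  "lcomb q c g w i = vec q (\<lambda>r. \<Sum>k<c. g $ k * w (k + i) $ r)"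

lemma lcomb_carrier[simp, intro]: "lcomb q c g w i \<in> carrier_vec q"
  and dim_lcomb[simp]: "dim_vec (lcomb q c g w i) = q"
  by (simp_all add: lcomb_def)

lemma scalar_prod_lcomb:
  assumes "\<And>k. k < c \<Longrightarrow> w (k + i) \<in> carrier_vec q"
  shows "v \<bullet> lcomb q c g w i = (\<Sum>k<c. g $ k * (v \<bullet> w (k + i)))"
proof -
  have "v \<bullet> lcomb q c g w i = (\<Sum>r<q. \<Sum>k<c. v $ r * (g $ k * w (k + i) $ r))"
    by (simp add: scalar_prod_def lcomb_def sum_distrib_left atLeast0LessThan)
  also have "\<dots> = (\<Sum>k<c. \<Sum>r<q. v $ r * (g $ k * w (k + i) $ r))" by (rule sum.swap)
  also have "\<dots> = (\<Sum>k<c. g $ k * (v \<bullet> w (k + i)))"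
  proof (intro sum.cong refl)
    fix k assume "k \<in> {..<c}"
    hence "dim_vec (w (k + i)) = q" using assms by auto
    thus "(\<Sum>r<q. v $ r * (g $ k * w (k + i) $ r)) = g $ k * (v \<bullet> w (k + i))"
      by (simp add: scalar_prod_def sum_distrib_left atLeast0LessThan mult_ac)
  qed
  finally show ?thesis .
qed

lemma mult_mat_vec_lcomb:
  assumes "X \<in> carrier_mat p q" and "\<And>k. k < c \<Longrightarrow> w (k + i) \<in> carrier_vec q"
  shows "X *\<^sub>v lcomb q c g w i = lcomb p c g (\<lambda>k. X *\<^sub>v w k) i"
  using assms by (intro eq_vecI) (auto simp: scalar_prod_lcomb lcomb_def[of p])

lemma lcomb_add:
  assumes "\<And>k. k < c \<Longrightarrow> w (k + i) \<in> carrier_vec q" "\<And>k. k < c \<Longrightarrow> w' (k + i) \<in> carrier_vec q"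
  shows "lcomb q c g w i + lcomb q c g w' i = lcomb q c g (\<lambda>k. w k + w' k) i"
proof (rule eq_vecI)
  fix r assume "r < dim_vec (lcomb q c g (\<lambda>k. w k + w' k) i)"
  hence r: "r < q" by simp
  have "(\<Sum>k<c. g $ k * (w (k + i) + w' (k + i)) $ r)
      = (\<Sum>k<c. g $ k * w (k + i) $ r + g $ k * w' (k + i) $ r)"
  proof (intro sum.cong refl)
    fix k assume "k \<in> {..<c}"
    hence "dim_vec (w' (k + i)) = q" using assms by auto
    thus "g $ k * (w (k + i) + w' (k + i)) $ r = g $ k * w (k + i) $ r + g $ k * w' (k + i) $ r"
      using r by (simp add: distrib_left)
  qed
  thus "(lcomb q c g w i + lcomb q c g w' i) $ r = lcomb q c g (\<lambda>k. w k + w' k) i $ r"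
    using r by (simp add: lcomb_def sum.distrib)
qed simp

lemma lcomb_cong:
  assumes "\<And>k. k < c \<Longrightarrow> w (k + i) = w' (k + i')"
  shows "lcomb q c g w i = lcomb q c g w' i'"
  using assms by (auto simp: lcomb_def intro!: eq_vecI sum.cong)

section \<open>Windows and Hankel matrices in terms of signals\<close>

lemma dim_window[simp]: "dim_vec (window q w a b) = q * (b + 1 - a)"
  by (simp add: window_def)

lemma window_carrier[intro]: "1 \<le> L \<Longrightarrow> window q w a (a + L - 1) \<in> carrier_vec (q * L)"
  by (auto intro!: carrier_vecI)

lemma window_cong:
  assumes "\<And>i. a \<le> i \<Longrightarrow> i \<le> b \<Longrightarrow> w i = w' i"
  shows "window q w a b = window q w' a b"
proof (rule eq_vecI)
  fix i assume "i < dim_vec (window q w' a b)"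
  hence i: "i < q * (b + 1 - a)" by simp
  have "i div q < b + 1 - a" using i by (intro less_mult_imp_div_less) (simp add: mult.commute)
  thus "window q w a b $ i = window q w' a b $ i"
    using i assms[of "a + i div q"] by (auto simp: window_def)
qed simp

lemma window_shift: "window q (\<lambda>i. w (s + i)) a b = window q w (s + a) (s + b)"
  by (rule eq_vecI) (auto simp: window_def add.assoc)

lemma unstack_carrier[simp, intro]: "unstack q v k \<in> carrier_vec q"
  by (simp add: unstack_def)

lemma unstack_window:
  assumes "k \<le> b - a" "a \<le> b" "w (a + k) \<in> carrier_vec q"
  shows "unstack q (window q w a b) k = w (a + k)"
proof (rule eq_vecI)
  fix i assume "i < dim_vec (w (a + k))"
  hence i: "i < q" using assms by simp
  have "k * q + i < (k + 1) * q" using i by simp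
  also have "\<dots> \<le> (b + 1 - a) * q" using assms by (intro mult_right_mono) auto
  finally show "unstack q (window q w a b) k $ i = w (a + k) $ i"
    using i by (simp add: unstack_def window_def mult.commute)
qed (use assms in \<open>simp add: unstack_def\<close>)

lemma window_unstack:
  assumes "v \<in> carrier_vec (q * L)" "1 \<le> L"
  shows "window q (unstack q v) 0 (L - 1) = v"
proof (rule eq_vecI)
  fix i assume "i < dim_vec v"
  hence "i < q * L" using assms by simp
  moreover from this have "0 < q" by (cases q) auto
  ultimately show "window q (unstack q v) 0 (L - 1) $ i = v $ i"
    using assms by (simp add: window_def unstack_def)
qed (use assms in auto)

text \<open>Cutting out a window commutes with combining shifts, so a linear functional of the
  combined window can be evaluated on the data windows one by one.\<close>

lemma window_lcomb:
  "window q (lcomb q c g w) a b = lcomb (q * (b + 1 - a)) c g (\<lambda>k. window q w (k + a) (k + b)) 0"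
proof (rule eq_vecI)
  fix i assume "i < dim_vec (lcomb (q * (b + 1 - a)) c g (\<lambda>k. window q w (k + a) (k + b)) 0)"
  hence i: "i < q * (b + 1 - a)" by simp
  hence "0 < q" by (cases q) auto
  with i show "window q (lcomb q c g w) a b $ i =
    lcomb (q * (b + 1 - a)) c g (\<lambda>k. window q w (k + a) (k + b)) 0 $ i"
    by (auto simp: window_def lcomb_def add.assoc intro!: sum.cong)
qed simp

lemma hankel_carrier[simp, intro]: "hankel q L N w \<in> carrier_mat (q * L) (N + 1 - L)"
  by (auto simp: hankel_def)

lemma col_hankel:
  assumes "k < N + 1 - L" "1 \<le> L"
  shows "col (hankel q L N w) k = window q w k (k + L - 1)"
  using assms by (intro eq_vecI) (auto simp: hankel_def mat_of_cols_index)

text \<open>The bridge from matrix products to signals: multiplying by a Hankel matrix superposes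
  time-shifted copies of the data.\<close>

lemma hankel_mult_vec:
  assumes "g \<in> carrier_vec (N + 1 - L)" "1 \<le> L"
  shows "hankel q L N w *\<^sub>v g = window q (lcomb q (N + 1 - L) g w) 0 (L - 1)"
proof -
  have "hankel q L N w *\<^sub>v g = lcomb (q * L) (N + 1 - L) g (\<lambda>k. window q w k (k + L - 1)) 0"
    using assms by (intro eq_vecI) (auto simp: lcomb_def hankel_def scalar_prod_def mat_of_cols_index
       atLeast0LessThan mult.commute intro!: sum.cong)
  also have "\<dots> = window q (lcomb q (N + 1 - L) g w) 0 (L - 1)"
    using assms by (simp add: window_lcomb)
  finally show ?thesis .
qed

subsection \<open>Trajectories\<close>

lemma sys_state_cong:
  assumes "\<And>i. i < k \<Longrightarrow> u i = u' i"
  shows "sys_state A B x0 u k = sys_state A B x0 u' k"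
  using assms by (induction k) auto

text \<open>Time invariance: the system may be restarted at time \<open>s\<close> from the state
  reached there.\<close>

lemma sys_state_shift:
  "sys_state A B x0 u (s + k) = sys_state A B (sys_state A B x0 u s) (\<lambda>i. u (s + i)) k"
  by (induction k) auto

context
  fixes n m :: nat and A B :: "real mat"
  assumes A: "A \<in> carrier_mat n n" and B: "B \<in> carrier_mat n m"
begin

lemma sys_state_carrier:
  assumes "x0 \<in> carrier_vec n"
  shows "sys_state A B x0 u k \<in> carrier_vec n"
  using A B assms by (induction k) (auto intro!: carrier_vecI)

text \<open>Superposition: a perturbation \<open>z\<close> of the initial state evolves as a free
  response, independently of the input.\<close>

lemma sys_state_add_initial:
  assumes "x0 \<in> carrier_vec n" "z \<in> carrier_vec n" "\<And>i. i < k \<Longrightarrow> u i \<in> carrier_vec m"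
  shows "sys_state A B (x0 + z) u k = sys_state A B x0 u k + A ^\<^sub>m k *\<^sub>v z"
  using assms(3)
proof (induction k)
  case (Suc k)
  \<comment> \<open>Matrix powers unfold with the new factor on the right, whereas the state
    recursion multiplies from the left.\<close>
  have "A * A ^\<^sub>m k = A ^\<^sub>m Suc k"
    using A by (induction k) (auto simp: assoc_mult_mat[of A n n _ n A n, symmetric])
  hence "A *\<^sub>v (A ^\<^sub>m k *\<^sub>v z) = A ^\<^sub>m Suc k *\<^sub>v z"
    using A assms by (metis assoc_mult_mat_vec pow_carrier_mat)
  moreover have "B *\<^sub>v u k \<in> carrier_vec n" "A *\<^sub>v sys_state A B x0 u k \<in> carrier_vec n"
    "A ^\<^sub>m Suc k *\<^sub>v z \<in> carrier_vec n" "A ^\<^sub>m k *\<^sub>v z \<in> carrier_vec n"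
    using A B by (auto intro!: carrier_vecI)
  moreover have "a + b + c = a + c + b"
    if "a \<in> carrier_vec n" "b \<in> carrier_vec n" "c \<in> carrier_vec n" for a b c :: "real vec"
    using that by (intro eq_vecI) auto
  ultimately show ?case
    using Suc sys_state_carrier[OF assms(1), of u k]
    by (simp add: mult_add_distrib_mat_vec[OF A] del: pow_mat.simps)
qed (use A assms in auto)

text \<open>Each data segment starting at a time \<open>k < c\<close> is a trajectory by time
  invariance, hence so is their combination by linearity. The input \<open>u'\<close> is prescribed
  on the first \<open>l\<close> steps only, which fixes the state up to and including time
  \<open>l\<close>.\<close>

lemma sys_state_lcomb:
  assumes "x0 \<in> carrier_vec n"
    and "\<And>k i. k < c \<Longrightarrow> i < l \<Longrightarrow> u (k + i) \<in> carrier_vec m"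
    and "\<And>i. i < l \<Longrightarrow> u' i = lcomb m c g u i"
    and "k \<le> l"
  shows "sys_state A B (lcomb n c g (sys_state A B x0 u) 0) u' k = lcomb n c g (sys_state A B x0 u) k"
  using assms(4)
proof (induction k)
  case (Suc k)
  let ?x = "sys_state A B x0 u"
  have "sys_state A B (lcomb n c g ?x 0) u' (Suc k) = A *\<^sub>v lcomb n c g ?x k + B *\<^sub>v lcomb m c g u k"
    using Suc assms by simp
  also have "\<dots> = lcomb n c g (\<lambda>k. A *\<^sub>v ?x k) k + lcomb n c g (\<lambda>k. B *\<^sub>v u k) k"
    using Suc.prems assms sys_state_carrier[OF assms(1)]
    by (simp add: mult_mat_vec_lcomb[OF A] mult_mat_vec_lcomb[OF B])
  also have "\<dots> = lcomb n c g (\<lambda>k. A *\<^sub>v ?x k + B *\<^sub>v u k) k"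
    using A B by (intro lcomb_add) (auto intro!: carrier_vecI)
  also have "\<dots> = lcomb n c g ?x (Suc k)"
    by (rule lcomb_cong) simp
  finally show ?case .
qed simp

lemma sys_state_zero:
  assumes "\<And>i. i < k \<Longrightarrow> u i = 0\<^sub>v m"
  shows "sys_state A B (0\<^sub>v n) u k = 0\<^sub>v n"
  using assms by (induction k) (use A B in auto)

end

section \<open>Full row rank of the state-input data matrix\<close>

text \<open>Combinations of the data reproduce every input of length \<open>L + n\<close>, but with
  an initial state that cannot be prescribed. A filter blind to free responses closes this gap, and
  controllability supplies a trajectory on which the functional takes the value
  \<open>\<xi> \<bullet> \<xi> + \<eta> \<bullet> \<eta>\<close>.\<close>

lemma persistently_exciting_left_kernel:
  assumes A: "A \<in> carrier_mat n n" and B: "B \<in> carrier_mat n m"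
    and L: "1 \<le> L" and ctrl: "controllable n m A B"
    and u: "\<And>k. k < N \<Longrightarrow> u k \<in> carrier_vec m"
    and pe: "persistently_exciting m (L + n) N u"
    and x0: "x0 \<in> carrier_vec n" and \<xi>: "\<xi> \<in> carrier_vec n" and \<eta>: "\<eta> \<in> carrier_vec (m * L)"
    and ker: "\<And>k. k < N + 1 - L \<Longrightarrow>
      \<xi> \<bullet> sys_state A B x0 u k + \<eta> \<bullet> window m u k (k + L - 1) = 0"
  shows "\<xi> = 0\<^sub>v n \<and> \<eta> = 0\<^sub>v (m * L)"
proof -
  \<comment> \<open>\<open>f z v k\<close> evaluates the functional at time \<open>k\<close> along
    the trajectory from \<open>z\<close> with input \<open>v\<close>; along the data themselves it
    vanishes by \<open>ker\<close>. The number \<open>c\<close> counts the data windows of length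
    \<open>L + n\<close>.\<close>
  define f where "f z v k = \<xi> \<bullet> sys_state A B z v k + \<eta> \<bullet> window m v k (k + L - 1)" for z v k
  define c where "c = N + 1 - (L + n)"
  obtain a :: "nat \<Rightarrow> real" and j0 where a: "j0 \<le> n" "a j0 \<noteq> 0"
    "\<And>x. x \<in> carrier_vec n \<Longrightarrow> (\<Sum>j\<le>n. a j * (\<xi> \<bullet> (A ^\<^sub>m j *\<^sub>v x))) = 0"
    using krylov_dependent[OF A \<xi>] by metis
  have filter: "(\<Sum>j\<le>n. a j * f z v j) = 0"
    if z: "z \<in> carrier_vec n" and v: "\<And>k. v k \<in> carrier_vec m" for z v
  proof -
    define x where "x = sys_state A B x0 u"
    have x: "x k \<in> carrier_vec n" for k unfolding x_def by (rule sys_state_carrier[OF A B x0])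
    have "window m v 0 (L + n - 1) \<in> carrier_vec (m * (L + n))"
      using L by (auto intro!: carrier_vecI)
    then obtain g where g: "g \<in> carrier_vec c" "hankel m (L + n) N u *\<^sub>v g = window m v 0 (L + n - 1)"
      using full_rank_surj[OF hankel_carrier pe[unfolded persistently_exciting_def]]
      unfolding c_def by blast
    have v_eq: "v i = lcomb m c g u i" if "i < L + n" for i
    proof -
      have "v i = unstack m (window m v 0 (L + n - 1)) i"
        using unstack_window[of i "L + n - 1" 0 v m] that v by simp
      also have "window m v 0 (L + n - 1) = window m (lcomb m c g u) 0 (L + n - 1)"
        using hankel_mult_vec[of g N "L + n" m u] g L unfolding c_def by simp
      also have "unstack m \<dots> i = lcomb m c g u i"
        using unstack_window[of i "L + n - 1" 0 "lcomb m c g u" m] that by simp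
      finally show ?thesis .
    qed
    \<comment> \<open>The initial state that comes with the combination reproducing
      \<open>v\<close>. In general it differs from \<open>z\<close>; the free response of
      \<open>z - z'\<close> is what the coefficients \<open>a\<close> cancel below.\<close>
    define z' where "z' = lcomb n c g x 0"
    have f0: "f z' v j = 0" if j: "j \<le> n" for j
    proof -
      have "sys_state A B z' v j = lcomb n c g x j"
        unfolding z'_def x_def
        by (rule sys_state_lcomb[OF A B x0, where l = "L + n"]) (use u v_eq j in \<open>auto simp: c_def\<close>)
      moreover have "window m v j (j + L - 1) = window m (lcomb m c g u) j (j + L - 1)"
        using j L by (intro window_cong v_eq) auto
      moreover have "\<dots> = lcomb (m * L) c g (\<lambda>k. window m u (k + j) (k + j + L - 1)) 0"
        using L by (simp add: window_lcomb add.assoc)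
      moreover have "\<eta> \<bullet> \<dots> = (\<Sum>k<c. g $ k * (\<eta> \<bullet> window m u (k + j) (k + j + L - 1)))"
        by (subst scalar_prod_lcomb) (use L in \<open>auto intro!: carrier_vecI\<close>)
      ultimately have "f z' v j = (\<Sum>k<c. g $ k * (\<xi> \<bullet> x (k + j)))
          + (\<Sum>k<c. g $ k * (\<eta> \<bullet> window m u (k + j) (k + j + L - 1)))"
        unfolding f_def using x by (simp add: scalar_prod_lcomb)
      also have "\<dots> = (\<Sum>k<c. g $ k * (\<xi> \<bullet> x (k + j) + \<eta> \<bullet> window m u (k + j) (k + j + L - 1)))"
        by (simp add: sum.distrib distrib_left)
      also have "\<dots> = 0"
      proof (intro sum.neutral ballI)
        fix k assume "k \<in> {..<c}"
        \<comment> \<open>This is where the extra order \<open>n\<close> of excitation pays off: a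
          window of length \<open>L\<close> delayed by \<open>j \<le> n\<close> still lies inside
          the data.\<close>
        hence "k + j < N + 1 - L" using j by (auto simp: c_def)
        thus "g $ k * (\<xi> \<bullet> x (k + j) + \<eta> \<bullet> window m u (k + j) (k + j + L - 1)) = 0"
          using ker[of "k + j"] by (simp add: x_def)
      qed
      finally show ?thesis .
    qed
    have z': "z' \<in> carrier_vec n" by (simp add: z'_def)
    have zz': "z' + (z - z') = z" and dz: "z - z' \<in> carrier_vec n"
      using z z' by (auto intro!: eq_vecI)
    have "f z v j = f z' v j + \<xi> \<bullet> (A ^\<^sub>m j *\<^sub>v (z - z'))" for j
    proof -
      have "A ^\<^sub>m j *\<^sub>v (z - z') \<in> carrier_vec n" using A by (auto intro!: carrier_vecI)
      hence "\<xi> \<bullet> sys_state A B z v j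
          = \<xi> \<bullet> sys_state A B z' v j + \<xi> \<bullet> (A ^\<^sub>m j *\<^sub>v (z - z'))"
        using sys_state_add_initial[OF A B z' dz, of j v, unfolded zz'] v
          scalar_prod_add_distrib[OF \<xi> sys_state_carrier[OF A B z', of v j]] by simp
      thus ?thesis by (simp add: f_def)
    qed
    hence "(\<Sum>j\<le>n. a j * f z v j) = (\<Sum>j\<le>n. a j * (\<xi> \<bullet> (A ^\<^sub>m j *\<^sub>v (z - z'))))"
      using f0 by (intro sum.cong) auto
    thus ?thesis using a(3)[of "z - z'"] z z' by simp
  qed
  \<comment> \<open>Time invariance carries the filter identity from time 0 to every time
    \<open>k\<close>.\<close>
  have rec: "(\<Sum>j\<le>n. a j * f z v (k + j)) = 0"
    if z: "z \<in> carrier_vec n" and v: "\<And>k. v k \<in> carrier_vec m" for z v k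
  proof -
    have "f z v (k + j) = f (sys_state A B z v k) (\<lambda>i. v (k + i)) j" for j
      unfolding f_def using L
      by (simp add: sys_state_shift window_shift add.assoc)
    thus ?thesis
      using filter[of "sys_state A B z v k" "\<lambda>i. v (k + i)"] sys_state_carrier[OF A B z] v by simp
  qed
  \<comment> \<open>Since \<open>a n\<close> may vanish, the recurrence is solved at the largest
    index with a nonzero coefficient, so that the remaining terms involve earlier times
    only.\<close>
  define r where "r = Max {j. j \<le> n \<and> a j \<noteq> 0}"
  have "r \<in> {j. j \<le> n \<and> a j \<noteq> 0}" unfolding r_def using a by (intro Max_in) auto
  hence r: "r \<le> n" "a r \<noteq> 0" by auto
  have r_max: "a j = 0" if "r < j" "j \<le> n" for j
  proof (rule ccontr)
    assume "a j \<noteq> 0"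
    hence "j \<le> r" unfolding r_def using that by (intro Max_ge) auto
    thus False using that by simp
  qed
  \<comment> \<open>For \<open>k \<le> n\<close> the window ends at
    \<open>k + L - 1 < L + n\<close>, where the input still rests and the state is still zero. For
    \<open>k > n\<close> the recurrence started at \<open>k - r\<close> expresses the value at
    \<open>k\<close> through earlier ones.\<close>
  have zero: "f (0\<^sub>v n) v k = 0"
    if v: "\<And>k. v k \<in> carrier_vec m" and v0: "\<And>i. i < L + n \<Longrightarrow> v i = 0\<^sub>v m" for v k
  proof (induction k rule: less_induct)
    case (less k)
    show ?case
    proof (cases "k \<le> n")
      case True
      have "window m v k (k + L - 1) = 0\<^sub>v (m * L)"
      proof (rule eq_vecI)
        fix i assume "i < dim_vec (0\<^sub>v (m * L))"
        hence i: "i < L * m" by (simp add: mult.commute)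
        hence "0 < m" by (cases m) auto
        hence "i div m < L" "i mod m < m" using i by (simp_all add: less_mult_imp_div_less)
        thus "window m v k (k + L - 1) $ i = 0\<^sub>v (m * L) $ i"
          using i True L v0[of "k + i div m"] by (simp add: window_def mult.commute)
      qed (use L in simp)
      moreover have "sys_state A B (0\<^sub>v n) v k = 0\<^sub>v n"
        using True L v0 by (intro sys_state_zero[OF A B]) auto
      ultimately show ?thesis using \<xi> \<eta> by (simp add: f_def)
    next
      case False
      define k' where "k' = k - r"
      have k: "k = k' + r" using False r by (simp add: k'_def)
      have "(\<Sum>j\<le>n. a j * f (0\<^sub>v n) v (k' + j)) = (\<Sum>j\<in>{r}. a j * f (0\<^sub>v n) v (k' + j))"
      proof (rule sum.mono_neutral_right)
        show "\<forall>j\<in>{..n} - {r}. a j * f (0\<^sub>v n) v (k' + j) = 0"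
        proof
          fix j assume "j \<in> {..n} - {r}"
          hence "j < r \<or> r < j \<and> j \<le> n" by auto
          thus "a j * f (0\<^sub>v n) v (k' + j) = 0"
            using less.IH[of "k' + j"] r_max[of j] by (auto simp: k)
        qed
      qed (use r in auto)
      thus ?thesis using rec[of "0\<^sub>v n" v k'] v r(2) by (simp add: k)
    qed
  qed
  obtain w T where w: "\<And>k. w k \<in> carrier_vec m" "sys_state A B (0\<^sub>v n) w T = \<xi>"
    using ctrl \<xi> unfolding controllable_def by (metis zero_carrier_vec)
  define s where "s = L + n"
  \<comment> \<open>Three phases: rest for \<open>L + n\<close> steps, as \<open>zero\<close>
    demands; then \<open>T\<close> steps steering the origin to \<open>\<xi>\<close> itself; then
    \<open>\<eta>\<close> fed in as the input. At time \<open>s + T\<close> the functional thus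
    meets exactly the pair that represents it.\<close>
  define v where "v i = (if i < s then 0\<^sub>v m else if i < s + T then w (i - s)
    else unstack m \<eta> (i - (s + T)))" for i
  have v: "v i \<in> carrier_vec m" for i using w by (simp add: v_def)
  have "sys_state A B (0\<^sub>v n) v s = 0\<^sub>v n"
    by (intro sys_state_zero[OF A B]) (simp add: v_def)
  hence "sys_state A B (0\<^sub>v n) v (s + T) = sys_state A B (0\<^sub>v n) (\<lambda>i. v (s + i)) T"
    using sys_state_shift[of A B "0\<^sub>v n" v s T] by simp
  also have "\<dots> = \<xi>"
    unfolding w(2)[symmetric] by (intro sys_state_cong) (simp add: v_def)
  finally have "sys_state A B (0\<^sub>v n) v (s + T) = \<xi>" .
  moreover have "window m v (s + T) (s + T + L - 1) = window m (\<lambda>i. v (s + T + i)) 0 (L - 1)"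
    using L by (simp add: window_shift)
  hence "window m v (s + T) (s + T + L - 1) = \<eta>"
    using window_unstack[OF \<eta> L] by (simp add: v_def)
  ultimately have "\<xi> \<bullet> \<xi> + \<eta> \<bullet> \<eta> = 0"
    using zero[of v "s + T"] v by (simp add: f_def) (simp add: v_def s_def)
  hence "\<xi> \<bullet> \<xi> = 0 \<and> \<eta> \<bullet> \<eta> = 0"
    using scalar_prod_self_nonneg[of \<xi>] scalar_prod_self_nonneg[of \<eta>] by linarith
  thus ?thesis using \<xi> \<eta> scalar_prod_self_eq_0_iff by blast
qed

section \<open>The image equality for input-output data\<close>

lemma col_append_rows:
  assumes "X \<in> carrier_mat r1 c" "Y \<in> carrier_mat r2 c" "k < c"
  shows "col (X @\<^sub>r Y) k = col X k @\<^sub>v col Y k"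
  using assms by (intro eq_vecI) (auto simp: append_rows_def)

lemma append_vec_cases:
  assumes "v \<in> carrier_vec (a + b)"
  obtains v1 v2 where "v1 \<in> carrier_vec a" "v2 \<in> carrier_vec b" "v = v1 @\<^sub>v v2"
  using assms vec_first_last_append[OF assms] vec_first_carrier vec_last_carrier by metis

lemma col_hankel_one:
  assumes "k < N" "w k \<in> carrier_vec n"
  shows "col (hankel n 1 N w) k = w k"
  using assms col_hankel[of k N 1 n w] by (auto simp: window_def intro!: eq_vecI)

lemma hankel_one_mult_vec:
  assumes "g \<in> carrier_vec N"
  shows "hankel n 1 N w *\<^sub>v g = lcomb n N g w 0"
  using assms hankel_mult_vec[of g N 1 n w]
  by (auto simp: window_def intro!: eq_vecI)

text \<open>Every combination of data columns is a trajectory, by linearity (\<open>out\<close>).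
  Conversely, initial state and input determine the output, so it suffices to match these two by
  data (\<open>surj\<close>).\<close>

lemma fundamental_lemma:
  assumes L: "1 \<le> L" and sys: "(A, B, C, D) \<in> controllable_systems n m p"
    and u: "\<And>k. k < N \<Longrightarrow> u k \<in> carrier_vec m"
    and pe: "persistently_exciting m (L + n) N u"
    and x0: "x0 \<in> carrier_vec n"
  shows "vec_space.col_space (m * L + p * L)
            (hankel m L N u @\<^sub>r hankel p L N (sys_output (A, B, C, D) x0 u))
          = {ubar @\<^sub>v window p (sys_output (A, B, C, D) xbar0 (unstack m ubar)) 0 (L - 1) | ubar xbar0.
               ubar \<in> carrier_vec (m * L) \<and> xbar0 \<in> carrier_vec n}"
proof -
  have A: "A \<in> carrier_mat n n" and B: "B \<in> carrier_mat n m" and C: "C \<in> carrier_mat p n"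
    and D: "D \<in> carrier_mat p m" and ctrl: "controllable n m A B"
    using sys by (auto simp: controllable_systems_def)
  define c where "c = N + 1 - L"
  define x where "x = sys_state A B x0 u"
  define y where "y = sys_output (A, B, C, D) x0 u"
  have x: "x k \<in> carrier_vec n" for k unfolding x_def by (rule sys_state_carrier[OF A B x0])
  have u': "u (k + i) \<in> carrier_vec m" if "k < c" "i < L" for k i
    using that by (intro u) (auto simp: c_def)
  have Hu: "hankel m L N u \<in> carrier_mat (m * L) c" and Hy: "hankel p L N y \<in> carrier_mat (p * L) c"
    unfolding c_def by (rule hankel_carrier)+
  \<comment> \<open>The initial state witnessing a vector of the image is the same combination of
    the data states, \<open>lcomb n c g x 0\<close>.\<close>
  have out: "hankel p L N y *\<^sub>v g =
      window p (sys_output (A, B, C, D) (lcomb n c g x 0) (unstack m (hankel m L N u *\<^sub>v g))) 0 (L - 1)"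
    if g: "g \<in> carrier_vec c" for g
  proof -
    have Hug: "unstack m (hankel m L N u *\<^sub>v g) i = lcomb m c g u i" if "i < L" for i
      using unstack_window[of i "L - 1" 0 "lcomb m c g u" m] hankel_mult_vec[of g N L m u] g L that
      by (simp add: c_def)
    have "hankel p L N y *\<^sub>v g = window p (lcomb p c g y) 0 (L - 1)"
      using hankel_mult_vec[of g N L p y] g L by (simp add: c_def)
    also have "\<dots> = window p (sys_output (A, B, C, D) (lcomb n c g x 0)
      (unstack m (hankel m L N u *\<^sub>v g))) 0 (L - 1)"
    proof (rule window_cong)
      fix i assume "i \<le> L - 1"
      hence i: "i < L" using L by simp
      have "sys_state A B (lcomb n c g x 0) (unstack m (hankel m L N u *\<^sub>v g)) i = lcomb n c g x i"
        unfolding x_def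
        by (rule sys_state_lcomb[OF A B x0, where l = L]) (use u' Hug i in auto)
      hence "sys_output (A, B, C, D) (lcomb n c g x 0) (unstack m (hankel m L N u *\<^sub>v g)) i
          = C *\<^sub>v lcomb n c g x i + D *\<^sub>v lcomb m c g u i"
        by (simp add: sys_output_def Hug[OF i])
      also have "\<dots> = lcomb p c g (\<lambda>k. C *\<^sub>v x k) i + lcomb p c g (\<lambda>k. D *\<^sub>v u k) i"
        using x u' i by (simp add: mult_mat_vec_lcomb[OF C] mult_mat_vec_lcomb[OF D])
      also have "\<dots> = lcomb p c g (\<lambda>k. C *\<^sub>v x k + D *\<^sub>v u k) i"
        using C D by (intro lcomb_add) (auto intro!: carrier_vecI)
      finally show "lcomb p c g y i
          = sys_output (A, B, C, D) (lcomb n c g x 0) (unstack m (hankel m L N u *\<^sub>v g)) i"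
        by (simp add: y_def x_def sys_output_def cong: lcomb_cong)
    qed
    finally show ?thesis .
  qed
  have surj: "\<exists>g \<in> carrier_vec c. lcomb n c g x 0 = xbar0 \<and> hankel m L N u *\<^sub>v g = ubar"
    if "ubar \<in> carrier_vec (m * L)" "xbar0 \<in> carrier_vec n" for ubar xbar0
  proof -
    \<comment> \<open>Taking \<open>c\<close> as the signal length gives the first block the columns
      \<open>x 0\<close>, ..., \<open>x (N - L)\<close>, as many as the input block has.\<close>
    let ?G = "hankel n 1 c x @\<^sub>r hankel m L N u"
    have Hx: "hankel n 1 c x \<in> carrier_mat n c" using hankel_carrier[of n 1 c x] by simp
    have G: "?G \<in> carrier_mat (n + m * L) c" using Hx Hu by (rule carrier_append_rows)
    have "\<exists>g \<in> carrier_vec c. ?G *\<^sub>v g = xbar0 @\<^sub>v ubar"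
    proof (rule trivial_left_kernel_surj[OF G])
      fix v assume v: "v \<in> carrier_vec (n + m * L)" and ker: "\<And>k. k < c \<Longrightarrow> v \<bullet> col ?G k = 0"
      obtain \<xi> \<eta> where v12: "\<xi> \<in> carrier_vec n" "\<eta> \<in> carrier_vec (m * L)" "v = \<xi> @\<^sub>v \<eta>"
        using append_vec_cases[OF v] .
      have "\<xi> = 0\<^sub>v n \<and> \<eta> = 0\<^sub>v (m * L)"
      proof (rule persistently_exciting_left_kernel[OF A B L ctrl u pe x0 v12(1,2)])
        fix k assume k: "k < N + 1 - L"
        hence "col (hankel n 1 c x) k = x k"
          using x by (intro col_hankel_one) (simp_all add: c_def)
        hence "col ?G k = x k @\<^sub>v window m u k (k + L - 1)"
          using col_append_rows[OF Hx Hu, of k] col_hankel[OF k L, of m u] k by (simp add: c_def)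
        thus "\<xi> \<bullet> sys_state A B x0 u k + \<eta> \<bullet> window m u k (k + L - 1) = 0"
          using ker[of k] k v12 x[of k] window_carrier[OF L, of m u k]
          by (simp add: scalar_prod_append[of _ n _ "m * L"] c_def x_def)
      qed
      thus "v = 0\<^sub>v (n + m * L)" using v12 by (intro eq_vecI) auto
    qed (use that in auto)
    then obtain g where g: "g \<in> carrier_vec c" "?G *\<^sub>v g = xbar0 @\<^sub>v ubar" by blast
    hence "lcomb n c g x 0 @\<^sub>v (hankel m L N u *\<^sub>v g) = xbar0 @\<^sub>v ubar"
      using mat_mult_append[OF Hx Hu g(1)] hankel_one_mult_vec[OF g(1), of n x] by simp
    hence "lcomb n c g x 0 = xbar0 \<and> hankel m L N u *\<^sub>v g = ubar"
      using append_vec_eq[of "lcomb n c g x 0" n xbar0] that by simp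
    thus ?thesis using g by blast
  qed
  have H: "hankel m L N u @\<^sub>r hankel p L N y \<in> carrier_mat (m * L + p * L) c"
    using Hu Hy by (rule carrier_append_rows)
  have "vec_space.col_space (m * L + p * L) (hankel m L N u @\<^sub>r hankel p L N y)
      = {v. \<exists>g \<in> carrier_vec c. v = (hankel m L N u *\<^sub>v g) @\<^sub>v (hankel p L N y *\<^sub>v g)}"
  proof -
    have "vec_space.col_space (m * L + p * L) (hankel m L N u @\<^sub>r hankel p L N y)
        = {v. \<exists>g \<in> carrier_vec c. v = (hankel m L N u @\<^sub>r hankel p L N y) *\<^sub>v g}"
      unfolding vec_space.col_space_eq[OF H] carrier_matD[OF H]
      using mult_mat_vec_carrier[OF H] by blast
    thus ?thesis by (auto simp: mat_mult_append[OF Hu Hy])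
  qed
  also have "\<dots> = {ubar @\<^sub>v window p (sys_output (A, B, C, D) xbar0 (unstack m ubar)) 0 (L - 1) | ubar xbar0.
               ubar \<in> carrier_vec (m * L) \<and> xbar0 \<in> carrier_vec n}" (is "?L = ?R")
  proof
    show "?L \<subseteq> ?R"
    proof
      fix v assume "v \<in> ?L"
      then obtain g where g: "g \<in> carrier_vec c" "v = (hankel m L N u *\<^sub>v g) @\<^sub>v (hankel p L N y *\<^sub>v g)"
        by blast
      moreover have "hankel m L N u *\<^sub>v g \<in> carrier_vec (m * L)"
        using Hu g by (auto intro!: carrier_vecI)
      moreover have "v = (hankel m L N u *\<^sub>v g) @\<^sub>v window p
          (sys_output (A, B, C, D) (lcomb n c g x 0) (unstack m (hankel m L N u *\<^sub>v g))) 0 (L - 1)"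
        unfolding out[OF g(1), symmetric] by (rule g(2))
      ultimately show "v \<in> ?R" using lcomb_carrier[of n c g x 0] by blast
    qed
    show "?R \<subseteq> ?L"
    proof
      fix v assume "v \<in> ?R"
      then obtain ubar xbar0 where b: "ubar \<in> carrier_vec (m * L)" "xbar0 \<in> carrier_vec n"
        "v = ubar @\<^sub>v window p (sys_output (A, B, C, D) xbar0 (unstack m ubar)) 0 (L - 1)"
        by blast
      then obtain g where g: "g \<in> carrier_vec c" "lcomb n c g x 0 = xbar0" "hankel m L N u *\<^sub>v g = ubar"
        using surj by blast
      have "v = (hankel m L N u *\<^sub>v g) @\<^sub>v (hankel p L N y *\<^sub>v g)"
        unfolding out[OF g(1)] g(2,3) by (rule b(3))
      thus "v \<in> ?L" using g(1) by blast
    qed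
  qed
  finally show ?thesis unfolding y_def .
qed

subsection \<open>The matrix Z as a filter\<close>

lemma sum_blocks:
  fixes F :: "nat \<Rightarrow> real"
  shows "(\<Sum>c<m * K. F c) = (\<Sum>l<K. \<Sum>b<m. F (l * m + b))"
proof -
  have "(\<Sum>c<m * K. F c) = (\<Sum>l<K. sum F {l * m..<l * m + m})"
    by (simp add: sum.nat_group mult.commute)
  also have "\<dots> = (\<Sum>l<K. \<Sum>b<m. F (l * m + b))"
  proof (rule sum.cong[OF refl])
    fix l
    show "sum F {l * m..<l * m + m} = (\<Sum>b<m. F (l * m + b))"
      using sum.shift_bounds_nat_ivl[of F 0 "l * m" m] by (simp add: atLeast0LessThan add.commute)
  qed
  finally show ?thesis .
qed

lemma block_less_iff:
  fixes l b m K :: nat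
  assumes "b < m"
  shows "l * m + b < m * K \<longleftrightarrow> l < K"
proof
  assume "l * m + b < m * K"
  hence "(l * m + b) div m < K" by (intro less_mult_imp_div_less) (simp add: mult.commute)
  thus "l < K" using assms by simp
next
  assume "l < K"
  have "l * m + b < (l + 1) * m" using assms by simp
  also have "\<dots> \<le> K * m" using \<open>l < K\<close> by (intro mult_right_mono) auto
  finally show "l * m + b < m * K" by (simp add: mult.commute)
qed

lemmas block_less = block_less_iff[THEN iffD2, rotated]

text \<open>The two block rows are partitioned independently; they can be stacked because both have
  total width \<open>m * (L + n)\<close>, which uses \<open>L \<ge> 1\<close>.\<close>

lemma Z_carrier:
  assumes "1 \<le> L"
  shows "Z_mat n m L A B d \<in> carrier_mat (n + m * L) (m * (L + n))"
proof -
  have append_cols: "append_cols X Y \<in> carrier_mat r (c1 + c2)"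
    if "X \<in> carrier_mat r c1" "Y \<in> carrier_mat r c2" for X Y r c1 c2
    using that by (auto simp: append_cols_def)
  obtain L' where L': "L = Suc L'" using assms by (cases L) auto
  have top: "append_cols (M_mat n m A B d) (0\<^sub>m (m + n) (m * (L - 1))) \<in> carrier_mat (n + m) (m * (n + 1) + m * (L - 1))"
    by (rule append_cols) (simp_all add: M_mat_def add.commute)
  have "append_cols (0\<^sub>m (m * (L - 1)) m) (kronecker (T_mat n L d) (1\<^sub>m m))
    \<in> carrier_mat (m * (L - 1)) (m + (L + n - 1) * m)"
    by (rule append_cols) (simp_all add: kronecker_def T_mat_def mult.commute)
  also have "m + (L + n - 1) * m = m * (n + 1) + m * (L - 1)"
    by (simp add: L' algebra_simps)
  finally have "append_cols (0\<^sub>m (m * (L - 1)) m) (kronecker (T_mat n L d) (1\<^sub>m m))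
    \<in> carrier_mat (m * (L - 1)) (m * (n + 1) + m * (L - 1))" .
  with top have "Z_mat n m L A B d \<in> carrier_mat (n + m + m * (L - 1)) (m * (n + 1) + m * (L - 1))"
    unfolding Z_mat_def by (rule carrier_append_rows)
  thus ?thesis by (simp add: L' algebra_simps)
qed

lemma markov_ext_index:
  assumes A: "A \<in> carrier_mat n n" and B: "B \<in> carrier_mat n m" and r: "r < n + m" and b: "b < m"
  shows "markov_ext n m A B q $$ (r, b) =
    (if q = 0 then (if r < n then 0 else if r - n = b then 1 else 0)
     else if r < n then (A ^\<^sub>m (q - 1) * B) $$ (r, b) else 0)"
proof (cases "q = 0")
  case True
  thus ?thesis using r b by (auto simp: markov_ext_def D_ext_def append_rows_def)
next
  case False
  have AB: "A ^\<^sub>m (q - 1) * B \<in> carrier_mat n m" by (rule mult_carrier_mat[OF pow_carrier_mat[OF A] B])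
  have C: "C_ext n m \<in> carrier_mat (n + m) n" unfolding C_ext_def by (rule carrier_append_rows) auto
  have row: "row (C_ext n m) r = (if r < n then unit_vec n r else 0\<^sub>v n)"
    using r by (intro eq_vecI) (auto simp: C_ext_def append_rows_def)
  have "markov_ext n m A B q = C_ext n m * (A ^\<^sub>m (q - 1) * B)"
    using False A by (simp add: markov_ext_def assoc_mult_mat[OF C _ B])
  hence "markov_ext n m A B q $$ (r, b) = row (C_ext n m) r \<bullet> col (A ^\<^sub>m (q - 1) * B) b"
    using C AB r b by (metis carrier_matD index_mult_mat(1))
  also have "\<dots> = (if r < n then (A ^\<^sub>m (q - 1) * B) $$ (r, b) else 0)"
  proof -
    have "col (A ^\<^sub>m (q - 1) * B) b \<in> carrier_vec n" using AB by (metis carrier_matD(1) col_carrier_vec b carrier_matD(2))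
    moreover have "col (A ^\<^sub>m (q - 1) * B) b $ r = (A ^\<^sub>m (q - 1) * B) $$ (r, b)" if "r < n"
      using AB b that by (metis carrier_matD index_col)
    ultimately show ?thesis unfolding row by (auto simp: scalar_prod_left_unit)
  qed
  finally show ?thesis using False by simp
qed

text \<open>In the upper \<open>n\<close> rows only the Markov parameters with
  \<open>q \<ge> 1\<close> contribute, a convolution of \<open>d\<close> with the impulse response
  of the state. In the lower \<open>m\<close> rows only \<open>q = 0\<close> does, leaving
  \<open>d j\<close> times the identity.\<close>

lemma M_block_index:
  assumes A: "A \<in> carrier_mat n n" and B: "B \<in> carrier_mat n m" and r: "r < n + m" and b: "b < m"
  shows "M_block n m A B d j $$ (r, b) =
    (if r < n then \<Sum>q = 1..j. d (j - q) * (A ^\<^sub>m (q - 1) * B) $$ (r, b)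
     else if r - n = b then d j else 0)"
proof -
  have "M_block n m A B d j $$ (r, b) = (\<Sum>q = 0..j. d (j - q) * markov_ext n m A B q $$ (r, b))"
    using r b by (simp add: M_block_def mat_lincomb_def)
  also have "\<dots> = d j * markov_ext n m A B 0 $$ (r, b)
      + (\<Sum>q = 1..j. d (j - q) * markov_ext n m A B q $$ (r, b))"
    by (simp add: sum.atLeast_Suc_atMost)
  also have "\<dots> = (if r < n then \<Sum>q = 1..j. d (j - q) * (A ^\<^sub>m (q - 1) * B) $$ (r, b)
     else if r - n = b then d j else 0)"
    by (auto simp: markov_ext_index[OF assms] intro!: sum.cong)
  finally show ?thesis .
qed

lemma Z_index_state:
  assumes L: "1 \<le> L" and r: "r < n" and l: "l < L + n" and b: "b < m"
  shows "Z_mat n m L A B d $$ (r, l * m + b) = (if l \<le> n then M_block n m A B d (n - l) $$ (r, b) else 0)"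
proof -
  have c: "l * m + b < m * (L + n)" using block_less[OF l b] .
  have less: "l * m + b < m * (n + 1) \<longleftrightarrow> l \<le> n" using block_less_iff[OF b, of l "n + 1"] by auto
  obtain L' where L': "L = Suc L'" using L by (cases L) auto
  have "m * (L + n) = m * (n + 1) + m * (L - 1)" by (simp add: L' algebra_simps)
  thus ?thesis
    using r c b less unfolding Z_mat_def append_rows_def append_cols_def
    by (auto simp: M_mat_def simp del: mult_Suc_right)
qed

text \<open>The first input block row sits at the bottom of \<open>M\<close>, the other
  \<open>L - 1\<close> in the Kronecker product, displaced by one column block. Together they form a
  single banded pattern: block row \<open>i\<close> carries the coefficients of \<open>d\<close>,
  shifted by \<open>i\<close>.\<close>

lemma Z_index_input:
  assumes A: "A \<in> carrier_mat n n" and B: "B \<in> carrier_mat n m"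
    and i: "i < L" and b': "b' < m" and l: "l < L + n" and b: "b < m"
  shows "Z_mat n m L A B d $$ (n + i * m + b', l * m + b) =
    (if i \<le> l \<and> l \<le> i + n \<and> b' = b then d (n - (l - i)) else 0)"
proof -
  have c: "l * m + b < m * (L + n)" using block_less[OF l b] .
  have less: "l * m + b < m * (n + 1) \<longleftrightarrow> l \<le> n" using block_less_iff[OF b, of l "n + 1"] by auto
  obtain L' where L': "L = Suc L'" using i by (cases L) auto
  have w: "m * (L + n) = m * (n + 1) + m * (L - 1)" by (simp add: L' algebra_simps)
  show ?thesis
  proof (cases i)
    case 0
    have "Z_mat n m L A B d $$ (n + b', l * m + b)
        = (if l \<le> n then M_block n m A B d (n - l) $$ (n + b', b) else 0)"
      using b' c b less w unfolding Z_mat_def append_rows_def append_cols_def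
      by (auto simp: M_mat_def simp del: mult_Suc_right)
    thus ?thesis using 0 b b' by (auto simp: M_block_index[OF A B])
  next
    case (Suc i')
    have r: "n + i * m + b' = n + m + (i' * m + b')" using Suc by simp
    have r': "i' * m + b' < m * (L - 1)" using i Suc b' by (intro block_less) auto
    show ?thesis
    proof (cases l)
      case 0
      thus ?thesis unfolding r using r' b Suc w c unfolding Z_mat_def append_rows_def append_cols_def
        by (auto simp: M_mat_def simp del: mult_Suc_right)
    next
      case (Suc l')
      have c': "l * m + b = m + (l' * m + b)" using Suc by simp
      have c'': "l' * m + b < m * (L + n - 1)" using l Suc b by (intro block_less) auto
      have "Z_mat n m L A B d $$ (n + m + (i' * m + b'), m + (l' * m + b))
         = kronecker (T_mat n L d) (1\<^sub>m m) $$ (i' * m + b', l' * m + b)"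
        using r' c'' w c unfolding c' Z_mat_def append_rows_def append_cols_def
        by (auto simp: M_mat_def kronecker_def T_mat_def mult.commute simp del: mult_Suc_right)
      also have "\<dots> = (if i' \<le> l' \<and> l' \<le> i' + n \<and> b' = b then d (n - (l' - i')) else 0)"
        using r' c'' b b' i l Suc \<open>i = Suc i'\<close> by (auto simp: kronecker_def T_mat_def mult.commute)
      finally show ?thesis unfolding r c' using Suc \<open>i = Suc i'\<close> by simp
    qed
  qed
qed

text \<open>Variation of constants in one coordinate. The induction peels off the first time step
  rather than the last, replacing the initial state by its successor; hence \<open>z\<close> and
  \<open>v\<close> must vary.\<close>

lemma sys_state_expansion:
  assumes A: "A \<in> carrier_mat n n" and B: "B \<in> carrier_mat n m"
    and "z \<in> carrier_vec n" "\<And>i. i < k \<Longrightarrow> v i \<in> carrier_vec m" and r: "r < n"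
  shows "sys_state A B z v k $ r = (A ^\<^sub>m k *\<^sub>v z) $ r
    + (\<Sum>l<k. ((A ^\<^sub>m (k - 1 - l) * B) *\<^sub>v v l) $ r)"
  using assms(3,4)
proof (induction k arbitrary: z v)
  case 0
  thus ?case using A by simp
next
  case (Suc k)
  let ?z = "A *\<^sub>v z + B *\<^sub>v v 0"
  have Az: "A *\<^sub>v z \<in> carrier_vec n" and Bv: "B *\<^sub>v v 0 \<in> carrier_vec n"
    using A B by (auto intro!: carrier_vecI)
  have "sys_state A B z v (Suc k) $ r = sys_state A B ?z (\<lambda>i. v (1 + i)) k $ r"
    using sys_state_shift[of A B z v 1 k] by simp
  also have "\<dots> = (A ^\<^sub>m k *\<^sub>v ?z) $ r + (\<Sum>l<k. ((A ^\<^sub>m (k - 1 - l) * B) *\<^sub>v v (1 + l)) $ r)"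
    using Az Bv Suc.prems by (intro Suc.IH) auto
  also have "A ^\<^sub>m k *\<^sub>v ?z = A ^\<^sub>m Suc k *\<^sub>v z + (A ^\<^sub>m k * B) *\<^sub>v v 0"
    using mult_add_distrib_mat_vec[OF pow_carrier_mat[OF A] Az Bv]
      assoc_mult_mat_vec[OF pow_carrier_mat[OF A] A Suc.prems(1), of k]
      assoc_mult_mat_vec[OF pow_carrier_mat[OF A] B, of "v 0" k] Suc.prems(2)[of 0] by simp
  also have "\<dots> $ r = (A ^\<^sub>m Suc k *\<^sub>v z) $ r + ((A ^\<^sub>m k * B) *\<^sub>v v 0) $ r"
    using A B r by (simp del: pow_mat.simps)
  finally show ?case
    by (simp add: sum.lessThan_Suc_shift del: pow_mat.simps sum.lessThan_Suc)
qed

text \<open>One coordinate of \<open>d(A) z = 0\<close>, summed in reverse: as \<open>d 0\<close> is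
  the leading coefficient, \<open>A ^\<^sub>m j\<close> comes with \<open>d (n - j)\<close>.\<close>

lemma annihilating_coeffs_mult_vec:
  assumes A: "A \<in> carrier_mat n n" and d: "annihilating_coeffs n A d"
    and z: "z \<in> carrier_vec n" and r: "r < n"
  shows "(\<Sum>j\<le>n. d (n - j) * (A ^\<^sub>m j *\<^sub>v z) $ r) = 0"
proof -
  have entry: "(\<Sum>j\<le>n. d (n - j) * (A ^\<^sub>m j) $$ (r, s)) = 0" if s: "s < n" for s
  proof -
    have "mat_lincomb n n {0..n} d (\<lambda>j. A ^\<^sub>m (n - j)) $$ (r, s) = 0"
      using d r s by (simp add: annihilating_coeffs_def)
    hence "(\<Sum>j = 0..n. d j * (A ^\<^sub>m (n - j)) $$ (r, s)) = 0"
      using r s by (simp add: mat_lincomb_def)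
    thus ?thesis
      by (subst (asm) sum.atLeastAtMost_rev) (simp add: atLeast0AtMost)
  qed
  have "(\<Sum>j\<le>n. d (n - j) * (A ^\<^sub>m j *\<^sub>v z) $ r)
      = (\<Sum>j\<le>n. \<Sum>s<n. d (n - j) * (A ^\<^sub>m j) $$ (r, s) * z $ s)"
    using A z r by (simp add: scalar_prod_def sum_distrib_left atLeast0LessThan mult.assoc)
  also have "\<dots> = (\<Sum>s<n. (\<Sum>j\<le>n. d (n - j) * (A ^\<^sub>m j) $$ (r, s)) * z $ s)"
    by (subst sum.swap) (simp add: sum_distrib_right)
  also have "\<dots> = 0" by (simp add: entry)
  finally show ?thesis .
qed

text \<open>In the state rows, the combination with coefficients \<open>d\<close> cancels the free
  response, and collecting the forced response by input instant produces the blocks of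
  \<open>M\<close>. In the input rows the band structure performs the same combination.\<close>

lemma Z_mult_window:
  assumes A: "A \<in> carrier_mat n n" and B: "B \<in> carrier_mat n m" and L: "1 \<le> L"
    and d: "annihilating_coeffs n A d"
    and z: "z \<in> carrier_vec n" and v: "\<And>i. i < L + n \<Longrightarrow> v i \<in> carrier_vec m"
  shows "Z_mat n m L A B d *\<^sub>v window m v 0 (L + n - 1)
    = vec (n + m * L) (\<lambda>r. \<Sum>j\<le>n. d (n - j) * (sys_state A B z v j @\<^sub>v window m v j (j + L - 1)) $ r)"
    (is "?Z *\<^sub>v ?w = vec _ ?rhs")
proof (rule eq_vecI)
  note Z = Z_carrier[OF L, of n m A B d]
  note x = sys_state_carrier[OF A B z, of v]
  fix r assume "r < dim_vec (vec (n + m * L) ?rhs)"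
  hence r: "r < n + m * L" by simp
  have "(?Z *\<^sub>v ?w) $ r = (\<Sum>c<m * (L + n). ?Z $$ (r, c) * ?w $ c)"
    using Z r L by (simp add: scalar_prod_def atLeast0LessThan)
  also have "\<dots> = (\<Sum>l<L + n. \<Sum>b<m. ?Z $$ (r, l * m + b) * ?w $ (l * m + b))"
    by (rule sum_blocks)
  also have "\<dots> = (\<Sum>l<L + n. \<Sum>b<m. ?Z $$ (r, l * m + b) * v l $ b)"
  proof (intro sum.cong refl)
    fix l b assume "l \<in> {..<L + n}" "b \<in> {..<m}"
    hence "l * m + b < m * (L + n)" "b < m" by (auto intro: block_less)
    thus "?Z $$ (r, l * m + b) * ?w $ (l * m + b) = ?Z $$ (r, l * m + b) * v l $ b"
      using L by (simp add: window_def)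
  qed
  also have "\<dots> = ?rhs r"
  proof (cases "r < n")
    case True
    define G where "G q l = ((A ^\<^sub>m q * B) *\<^sub>v v l) $ r" for q l
    have "(\<Sum>l<L + n. \<Sum>b<m. ?Z $$ (r, l * m + b) * v l $ b)
        = (\<Sum>l<L + n. if l \<le> n then \<Sum>b<m. M_block n m A B d (n - l) $$ (r, b) * v l $ b else 0)"
      by (intro sum.cong) (auto simp: Z_index_state[OF L True])
    also have "\<dots> = (\<Sum>l\<le>n. \<Sum>b<m. M_block n m A B d (n - l) $$ (r, b) * v l $ b)"
      using L by (intro sum.mono_neutral_cong_right) auto
    also have "\<dots> = (\<Sum>l\<le>n. \<Sum>q = 1..n - l. d (n - l - q) * G (q - 1) l)"
    proof (rule sum.cong[OF refl])
      fix l assume "l \<in> {..n}"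
      hence vl: "v l \<in> carrier_vec m" using L v by auto
      have "(\<Sum>b<m. M_block n m A B d (n - l) $$ (r, b) * v l $ b)
          = (\<Sum>b<m. \<Sum>q = 1..n - l. d (n - l - q) * (A ^\<^sub>m (q - 1) * B) $$ (r, b) * v l $ b)"
        using True by (intro sum.cong) (auto simp: M_block_index[OF A B] sum_distrib_right)
      also have "\<dots> = (\<Sum>q = 1..n - l. \<Sum>b<m. d (n - l - q) * (A ^\<^sub>m (q - 1) * B) $$ (r, b) * v l $ b)"
        by (rule sum.swap)
      also have "\<dots> = (\<Sum>q = 1..n - l. d (n - l - q) * G (q - 1) l)"
      proof (intro sum.cong refl)
        fix q
        define X where "X = A ^\<^sub>m (q - 1) * B"
        have X: "X \<in> carrier_mat n m"
          unfolding X_def by (rule mult_carrier_mat[OF pow_carrier_mat[OF A] B])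
        have "G (q - 1) l = (\<Sum>b<m. X $$ (r, b) * v l $ b)"
          unfolding G_def X_def[symmetric] using X vl True by (simp add: scalar_prod_def atLeast0LessThan)
        thus "(\<Sum>b<m. d (n - l - q) * (A ^\<^sub>m (q - 1) * B) $$ (r, b) * v l $ b) = d (n - l - q) * G (q - 1) l"
          unfolding X_def[symmetric] by (simp add: sum_distrib_left mult.assoc)
      qed
      finally show "(\<Sum>b<m. M_block n m A B d (n - l) $$ (r, b) * v l $ b)
          = (\<Sum>q = 1..n - l. d (n - l - q) * G (q - 1) l)" .
    qed
    also have "\<dots> = (\<Sum>(l, q)\<in>Sigma {..n} (\<lambda>l. {1..n - l}). d (n - l - q) * G (q - 1) l)"
      by (rule sum.Sigma) auto
    \<comment> \<open>Substituting \<open>j = l + q\<close> turns block index and Markov index into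
      a time \<open>j\<close> and an earlier input instant \<open>l < j\<close>.\<close>
    also have "\<dots> = (\<Sum>(j, l)\<in>Sigma {..n} (\<lambda>j. {..<j}). d (n - j) * G (j - 1 - l) l)"
      by (rule sum.reindex_bij_witness[of _ "\<lambda>(j, l). (l, j - l)" "\<lambda>(l, q). (l + q, l)"]) auto
    also have "\<dots> = (\<Sum>j\<le>n. \<Sum>l<j. d (n - j) * G (j - 1 - l) l)"
      by (rule sum.Sigma[symmetric]) auto
    \<comment> \<open>Adding the vanishing term from \<open>d(A) = 0\<close> completes the forced
      response to the full state.\<close>
    also have "\<dots> = (\<Sum>j\<le>n. d (n - j) * (A ^\<^sub>m j *\<^sub>v z) $ r) + (\<Sum>j\<le>n. \<Sum>l<j. d (n - j) * G (j - 1 - l) l)"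
      by (simp only: annihilating_coeffs_mult_vec[OF A d z True] add_0)
    also have "\<dots> = (\<Sum>j\<le>n. d (n - j) * sys_state A B z v j $ r)"
      unfolding sum.distrib[symmetric]
    proof (intro sum.cong refl)
      fix j assume "j \<in> {..n}"
      hence "sys_state A B z v j $ r = (A ^\<^sub>m j *\<^sub>v z) $ r + (\<Sum>l<j. G (j - 1 - l) l)"
        unfolding G_def using L by (intro sys_state_expansion[OF A B z _ True] v) auto
      thus "d (n - j) * (A ^\<^sub>m j *\<^sub>v z) $ r + (\<Sum>l<j. d (n - j) * G (j - 1 - l) l)
          = d (n - j) * sys_state A B z v j $ r"
        by (simp add: distrib_left sum_distrib_left)
    qed
    also have "\<dots> = ?rhs r"
      using True x by (intro sum.cong) (auto simp: carrier_vecD[OF x])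
    finally show ?thesis .
  next
    case False
    define i b' where "i = (r - n) div m" and "b' = (r - n) mod m"
    have "0 < m" using r False by (cases m) auto
    have r_eq: "r = n + i * m + b'" using False by (simp add: i_def b'_def)
    have i: "i < L" unfolding i_def using r False
      by (intro less_mult_imp_div_less) (auto simp: mult.commute)
    have b': "b' < m" using \<open>0 < m\<close> by (simp add: b'_def)
    have "(\<Sum>l<L + n. \<Sum>b<m. ?Z $$ (r, l * m + b) * v l $ b)
        = (\<Sum>l<L + n. if i \<le> l \<and> l \<le> i + n then d (n - (l - i)) * v l $ b' else 0)"
    proof (intro sum.cong refl)
      fix l assume l: "l \<in> {..<L + n}"
      have "(\<Sum>b<m. ?Z $$ (r, l * m + b) * v l $ b)
          = (\<Sum>b<m. if b' = b then (if i \<le> l \<and> l \<le> i + n then d (n - (l - i)) * v l $ b else 0) else 0)"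
        using l unfolding r_eq by (intro sum.cong) (auto simp: Z_index_input[OF A B i b'])
      thus "(\<Sum>b<m. ?Z $$ (r, l * m + b) * v l $ b)
          = (if i \<le> l \<and> l \<le> i + n then d (n - (l - i)) * v l $ b' else 0)"
        using b' by (simp add: sum.delta)
    qed
    also have "\<dots> = (\<Sum>l\<in>{i..i + n}. d (n - (l - i)) * v l $ b')"
      using i by (intro sum.mono_neutral_cong_right) auto
    also have "\<dots> = (\<Sum>j\<le>n. d (n - j) * v (i + j) $ b')"
      by (rule sum.reindex_bij_witness[of _ "\<lambda>j. i + j" "\<lambda>l. l - i"]) auto
    also have "\<dots> = ?rhs r"
    proof (intro sum.cong refl)
      fix j
      have "(sys_state A B z v j @\<^sub>v window m v j (j + L - 1)) $ r = window m v j (j + L - 1) $ (i * m + b')"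
        using r L x[of j] unfolding r_eq by (simp add: carrier_vecD[OF x])
      also have "\<dots> = v (i + j) $ b'"
        using block_less[OF i b'] b' L by (simp add: window_def add.commute)
      finally show "d (n - j) * v (i + j) $ b'
          = d (n - j) * (sys_state A B z v j @\<^sub>v window m v j (j + L - 1)) $ r" by simp
    qed
    finally show ?thesis .
  qed
  finally show "(?Z *\<^sub>v ?w) $ r = vec (n + m * L) ?rhs $ r" using r by simp
qed (use Z_carrier[OF L, of n m A B d] in simp)

section \<open>Quadratic forms and the quantitative bound\<close>

lemma transpose_smult: "(a \<cdot>\<^sub>m X)\<^sup>T = a \<cdot>\<^sub>m X\<^sup>T"
  by (intro eq_matI) auto

lemma quadratic_form_gram:
  fixes X :: "real mat"
  assumes X: "X \<in> carrier_mat r c" and v: "v \<in> carrier_vec r"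
  shows "v \<bullet> ((X * X\<^sup>T) *\<^sub>v v) = (\<Sum>k<c. (v \<bullet> col X k)\<^sup>2)"
proof -
  have "v \<bullet> ((X * X\<^sup>T) *\<^sub>v v) = v \<bullet> (X *\<^sub>v (X\<^sup>T *\<^sub>v v))"
    using X v by (subst assoc_mult_mat_vec[OF X _ v]) auto
  also have "\<dots> = (X\<^sup>T *\<^sub>v v) \<bullet> (X\<^sup>T *\<^sub>v v)"
    using X v by (intro transpose_vec_mult_scalar[symmetric, OF X]) auto
  also have "\<dots> = (\<Sum>k<c. (v \<bullet> col X k)\<^sup>2)"
    using X v by (auto simp: scalar_prod_def[of "X\<^sup>T *\<^sub>v v"] power2_eq_square atLeast0LessThan
      comm_scalar_prod[of v r] intro!: sum.cong)
  finally show ?thesis .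
qed

text \<open>Expand the nonnegative sum of squares of \<open>b i - s * a i\<close>, with
  \<open>s\<close> the inner product of \<open>a\<close> and \<open>b\<close>.\<close>

lemma Cauchy_Schwarz_normalized:
  fixes a b :: "'a \<Rightarrow> real"
  assumes "(\<Sum>i\<in>I. (a i)\<^sup>2) = 1"
  shows "(\<Sum>i\<in>I. a i * b i)\<^sup>2 \<le> (\<Sum>i\<in>I. (b i)\<^sup>2)"
proof -
  define s where "s = (\<Sum>i\<in>I. a i * b i)"
  have "0 \<le> (\<Sum>i\<in>I. (b i - s * a i)\<^sup>2)" by (intro sum_nonneg) auto
  also have "\<dots> = (\<Sum>i\<in>I. (b i)\<^sup>2 - 2 * s * (a i * b i) + s\<^sup>2 * (a i)\<^sup>2)"
    by (intro sum.cong) (auto simp: power2_eq_square algebra_simps)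
  also have "\<dots> = (\<Sum>i\<in>I. (b i)\<^sup>2) - 2 * s * s + s\<^sup>2 * 1"
    unfolding s_def assms[symmetric] by (simp add: sum.distrib sum_subtractf sum_distrib_left)
  finally show ?thesis unfolding s_def[symmetric] by (simp add: power2_eq_square)
qed

text \<open>Both sides are compared as quadratic forms in \<open>v\<close>. Through
  \<open>w = Z\<^sup>T *\<^sub>v v\<close> the excitation bound on the input Hankel matrix becomes a
  sum of squares over its columns, which \<open>Z\<close> maps to filtered columns of
  \<open>H\<close>.\<close>

lemma quantitative_fundamental_lemma:
  assumes L: "1 \<le> L" and A: "A \<in> carrier_mat n n" and B: "B \<in> carrier_mat n m"
    and u: "\<And>k. k < N \<Longrightarrow> u k \<in> carrier_vec m"
    and pe: "K_persistently_exciting K m (L + n) N u"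
    and x0: "x0 \<in> carrier_vec n"
    and d: "annihilating_coeffs n A d"
    and H_def: "H = hankel n 1 (N + 1 - L) (sys_state A B x0 u) @\<^sub>r hankel m L N u"
    and Z_def: "Z = Z_mat n m L A B d"
  shows "loewner_ge (n + m * L) (H * H\<^sup>T) ((1 / (real n + 1)) \<cdot>\<^sub>m (Z * K * Z\<^sup>T))"
proof -
  define c where "c = N + 1 - L"
  define c' where "c' = N + 1 - (L + n)"
  define x where "x = sys_state A B x0 u"
  let ?U = "hankel m (L + n) N u"
  have x: "x k \<in> carrier_vec n" for k unfolding x_def by (rule sys_state_carrier[OF A B x0])
  have Hx: "hankel n 1 c x \<in> carrier_mat n c" using hankel_carrier[of n 1 c x] by simp
  have Hu: "hankel m L N u \<in> carrier_mat (m * L) c" unfolding c_def by (rule hankel_carrier)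
  have H: "H \<in> carrier_mat (n + m * L) c"
    unfolding H_def x_def[symmetric] c_def[symmetric] using Hx Hu by (rule carrier_append_rows)
  have Z: "Z \<in> carrier_mat (n + m * L) (m * (L + n))" unfolding Z_def by (rule Z_carrier[OF L])
  have U: "?U \<in> carrier_mat (m * (L + n)) c'" unfolding c'_def by (rule hankel_carrier)
  have K: "K \<in> carrier_mat (m * (L + n)) (m * (L + n))" "K\<^sup>T = K"
    using pe by (auto simp: K_persistently_exciting_def pos_def_def symmetric_real_mat_def)
  have psd: "0 \<le> w \<bullet> ((?U * ?U\<^sup>T - K) *\<^sub>v w)" if "w \<in> carrier_vec (m * (L + n))" for w
    using pe that by (auto simp: K_persistently_exciting_def loewner_ge_def pos_semidef_def)
  define h where "h k = x k @\<^sub>v window m u k (k + L - 1)" for k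
  have h: "h k \<in> carrier_vec (n + m * L)" for k
    unfolding h_def using x window_carrier[OF L] by (intro append_carrier_vec) auto
  have col_H: "col H k = h k" if k: "k < c" for k
  proof -
    show ?thesis
      using col_hankel_one[of k c x n, OF k x] col_append_rows[OF Hx Hu k] col_hankel[OF k[unfolded c_def] L, of m u]
      unfolding H_def x_def[symmetric] c_def[symmetric] h_def by simp
  qed
  \<comment> \<open>A column of the input Hankel matrix is an input window starting at time
    \<open>k\<close>; the filter identity applies to the system restarted from the state
    \<open>x k\<close>.\<close>
  have Z_col: "v \<bullet> (Z *\<^sub>v col ?U k) = (\<Sum>j\<le>n. d (n - j) * (v \<bullet> h (k + j)))"
    if k: "k < c'" and v: "v \<in> carrier_vec (n + m * L)" for k v
  proof -
    have "col ?U k = window m (\<lambda>i. u (k + i)) 0 (L + n - 1)"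
      using k L by (simp add: col_hankel c'_def window_shift)
    hence "Z *\<^sub>v col ?U k = vec (n + m * L) (\<lambda>r. \<Sum>j\<le>n. d (n - j) *
        (sys_state A B (x k) (\<lambda>i. u (k + i)) j @\<^sub>v window m (\<lambda>i. u (k + i)) j (j + L - 1)) $ r)"
      unfolding Z_def using k by (simp only:) (intro Z_mult_window[OF A B L d x] u, simp add: c'_def)
    also have "\<dots> = vec (n + m * L) (\<lambda>r. \<Sum>j\<le>n. d (n - j) * h (k + j) $ r)"
      using L by (simp add: h_def x_def sys_state_shift window_shift add.assoc)
    finally have "Z *\<^sub>v col ?U k = \<dots>" .
    hence "v \<bullet> (Z *\<^sub>v col ?U k) = (\<Sum>r<n + m * L. \<Sum>j\<le>n. v $ r * (d (n - j) * h (k + j) $ r))"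
      by (simp add: scalar_prod_def atLeast0LessThan sum_distrib_left)
    also have "\<dots> = (\<Sum>j\<le>n. \<Sum>r<n + m * L. v $ r * (d (n - j) * h (k + j) $ r))"
      by (rule sum.swap)
    also have "\<dots> = (\<Sum>j\<le>n. d (n - j) * (v \<bullet> h (k + j)))"
      by (simp add: scalar_prod_def carrier_vecD[OF h] atLeast0LessThan sum_distrib_left mult_ac)
    finally show ?thesis .
  qed
  have d1: "(\<Sum>j\<le>n. (d (n - j))\<^sup>2) = 1"
  proof -
    have "(\<Sum>j = 0..n. (d j)\<^sup>2) = 1" using d by (simp add: annihilating_coeffs_def)
    thus ?thesis by (subst (asm) sum.atLeastAtMost_rev) (simp add: atLeast0AtMost)
  qed
  have ZKZ: "Z * K * Z\<^sup>T \<in> carrier_mat (n + m * L) (n + m * L)" using Z K by auto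
  have HH: "H * H\<^sup>T \<in> carrier_mat (n + m * L) (n + m * L)" using H by auto
  have symH: "(H * H\<^sup>T)\<^sup>T = H * H\<^sup>T"
    using H by (simp add: transpose_mult[of H _ c])
  have symZ: "(Z * K * Z\<^sup>T)\<^sup>T = Z * K * Z\<^sup>T"
  proof -
    have ZK: "Z * K \<in> carrier_mat (n + m * L) (m * (L + n))" and ZT: "Z\<^sup>T \<in> carrier_mat (m * (L + n)) (n + m * L)"
      using Z K by auto
    have "(Z * K * Z\<^sup>T)\<^sup>T = Z * (Z * K)\<^sup>T"
      unfolding transpose_mult[OF ZK ZT] by simp
    also have "(Z * K)\<^sup>T = K * Z\<^sup>T" using Z K by (simp add: transpose_mult[of Z])
    also have "Z * (K * Z\<^sup>T) = Z * K * Z\<^sup>T" using Z K by (metis assoc_mult_mat transpose_carrier_mat)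
    finally show ?thesis .
  qed
  have bound: "v \<bullet> ((Z * K * Z\<^sup>T) *\<^sub>v v) \<le> (real n + 1) * (v \<bullet> ((H * H\<^sup>T) *\<^sub>v v))"
    if v: "v \<in> carrier_vec (n + m * L)" for v
  proof -
    define w where "w = Z\<^sup>T *\<^sub>v v"
    have w: "w \<in> carrier_vec (m * (L + n))" using Z v by (simp add: w_def)
    have "(Z * K * Z\<^sup>T) *\<^sub>v v = Z *\<^sub>v (K *\<^sub>v w)"
      unfolding w_def using Z K v
      by (subst assoc_mult_mat_vec[of _ "n + m * L" "m * (L + n)"]) auto
    hence "v \<bullet> ((Z * K * Z\<^sup>T) *\<^sub>v v) = w \<bullet> (K *\<^sub>v w)"
      unfolding w_def using Z K v by (simp add: transpose_vec_mult_scalar[OF Z])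
    also have "\<dots> \<le> w \<bullet> ((?U * ?U\<^sup>T) *\<^sub>v w)"
    proof -
      have UU: "?U * ?U\<^sup>T \<in> carrier_mat (m * (L + n)) (m * (L + n))" using U by auto
      have "w \<bullet> ((?U * ?U\<^sup>T - K) *\<^sub>v w) = w \<bullet> ((?U * ?U\<^sup>T) *\<^sub>v w) - w \<bullet> (K *\<^sub>v w)"
        unfolding minus_mult_distrib_mat_vec[OF UU K(1) w]
        using UU K w by (intro scalar_prod_minus_distrib) auto
      thus ?thesis using psd[OF w] by simp
    qed
    also have "\<dots> = (\<Sum>k<c'. (w \<bullet> col ?U k)\<^sup>2)" by (rule quadratic_form_gram[OF U w])
    also have "\<dots> = (\<Sum>k<c'. (\<Sum>j\<le>n. d (n - j) * (v \<bullet> h (k + j)))\<^sup>2)"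
    proof (intro sum.cong refl)
      fix k assume "k \<in> {..<c'}"
      moreover have "col ?U k \<in> carrier_vec (m * (L + n))" using U by (auto intro!: carrier_vecI)
      ultimately show "(w \<bullet> col ?U k)\<^sup>2 = (\<Sum>j\<le>n. d (n - j) * (v \<bullet> h (k + j)))\<^sup>2"
        unfolding w_def using v by (simp add: transpose_vec_mult_scalar[OF Z] Z_col)
    qed
    also have "\<dots> \<le> (\<Sum>k<c'. \<Sum>j\<le>n. (v \<bullet> h (k + j))\<^sup>2)"
      by (intro sum_mono Cauchy_Schwarz_normalized[OF d1])
    also have "\<dots> = (\<Sum>j\<le>n. \<Sum>k<c'. (v \<bullet> h (k + j))\<^sup>2)" by (rule sum.swap)
    \<comment> \<open>For each fixed delay \<open>j \<le> n\<close>, the shifted indices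
      \<open>k + j\<close> are distinct and stay below \<open>c\<close>. Each of the
      \<open>n + 1\<close> delays therefore contributes at most one full sum, whence the factor in
      the bound.\<close>
    also have "\<dots> \<le> (\<Sum>j\<le>n. \<Sum>k<c. (v \<bullet> h k)\<^sup>2)"
    proof (intro sum_mono)
      fix j assume j: "j \<in> {..n}"
      have "(\<Sum>k<c'. (v \<bullet> h (k + j))\<^sup>2) = (\<Sum>k\<in>(\<lambda>k. k + j) ` {..<c'}. (v \<bullet> h k)\<^sup>2)"
        by (simp add: sum.reindex inj_on_def)
      also have "\<dots> \<le> (\<Sum>k<c. (v \<bullet> h k)\<^sup>2)"
        using j by (intro sum_mono2) (auto simp: c_def c'_def)
      finally show "(\<Sum>k<c'. (v \<bullet> h (k + j))\<^sup>2) \<le> (\<Sum>k<c. (v \<bullet> h k)\<^sup>2)" .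
    qed
    also have "\<dots> = (real n + 1) * (\<Sum>k<c. (v \<bullet> h k)\<^sup>2)" by simp
    also have "(\<Sum>k<c. (v \<bullet> h k)\<^sup>2) = v \<bullet> ((H * H\<^sup>T) *\<^sub>v v)"
      unfolding quadratic_form_gram[OF H v] by (simp add: col_H)
    finally show ?thesis .
  qed
  have "0 \<le> v \<bullet> ((H * H\<^sup>T - (1 / (real n + 1)) \<cdot>\<^sub>m (Z * K * Z\<^sup>T)) *\<^sub>v v)"
    if v: "v \<in> carrier_vec (n + m * L)" for v
  proof -
    have sZ: "(1 / (real n + 1)) \<cdot>\<^sub>m (Z * K * Z\<^sup>T) \<in> carrier_mat (n + m * L) (n + m * L)"
      using ZKZ by simp
    have smult: "((1 / (real n + 1)) \<cdot>\<^sub>m (Z * K * Z\<^sup>T)) *\<^sub>v v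
        = (1 / (real n + 1)) \<cdot>\<^sub>v ((Z * K * Z\<^sup>T) *\<^sub>v v)"
      using ZKZ v by (intro eq_vecI) auto
    have "v \<bullet> ((H * H\<^sup>T - (1 / (real n + 1)) \<cdot>\<^sub>m (Z * K * Z\<^sup>T)) *\<^sub>v v)
        = v \<bullet> ((H * H\<^sup>T) *\<^sub>v v) - v \<bullet> (((1 / (real n + 1)) \<cdot>\<^sub>m (Z * K * Z\<^sup>T)) *\<^sub>v v)"
      unfolding minus_mult_distrib_mat_vec[OF HH sZ v]
      using HH sZ v by (intro scalar_prod_minus_distrib) auto
    also have "\<dots> = v \<bullet> ((H * H\<^sup>T) *\<^sub>v v) - (1 / (real n + 1)) * (v \<bullet> ((Z * K * Z\<^sup>T) *\<^sub>v v))"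
      unfolding smult using ZKZ v by (subst scalar_prod_smult_distrib[of _ "n + m * L"]) auto
    finally show ?thesis using bound[OF v] by (simp add: pos_divide_le_eq mult.commute)
  qed
  thus ?thesis
    unfolding loewner_ge_def pos_semidef_def symmetric_real_mat_def
    using HH ZKZ symH symZ minus_carrier_mat[of "(1 / (real n + 1)) \<cdot>\<^sub>m (Z * K * Z\<^sup>T)"]
    by (simp add: transpose_minus[of _ "n + m * L" "n + m * L"] transpose_smult)
qed

theorem mainTheorem4:
  fixes n m p L N :: nat and u :: "nat \<Rightarrow> real vec"
  assumes L: "L \<ge> 1"
    and u: "\<And>k. k < N \<Longrightarrow> u k \<in> carrier_vec m"
  shows
    "(persistently_exciting m (L + n) N u \<longrightarrow>
       (\<forall>S \<in> controllable_systems n m p. \<forall>x0 \<in> carrier_vec n.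
          vec_space.col_space (m * L + p * L)
            (hankel m L N u @\<^sub>r hankel p L N (sys_output S x0 u))
          = {ubar @\<^sub>v window p (sys_output S xbar0 (unstack m ubar)) 0 (L - 1) | ubar xbar0.
               ubar \<in> carrier_vec (m * L) \<and> xbar0 \<in> carrier_vec n}))
     \<and>
     (\<forall>K. K_persistently_exciting K m (L + n) N u \<longrightarrow>
       (\<forall>A B C D. (A, B, C, D) \<in> controllable_systems n m p \<longrightarrow>
         (\<forall>x0 \<in> carrier_vec n. \<forall>d. annihilating_coeffs n A d \<longrightarrow>
            (let H = hankel n 1 (N + 1 - L) (sys_state A B x0 u) @\<^sub>r hankel m L N u;
                 Z = Z_mat n m L A B d
             in loewner_ge (n + m * L) (H * H\<^sup>T)
                  ((1 / (real n + 1)) \<cdot>\<^sub>m (Z * K * Z\<^sup>T))))))"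
proof (intro conjI impI ballI allI)
  fix S and x0 :: "real vec"
  assume pe: "persistently_exciting m (L + n) N u" and S: "S \<in> controllable_systems n m p"
    and x0: "x0 \<in> carrier_vec n"
  obtain A B C D where "S = (A, B, C, D)" by (cases S)
  thus "vec_space.col_space (m * L + p * L)
            (hankel m L N u @\<^sub>r hankel p L N (sys_output S x0 u))
          = {ubar @\<^sub>v window p (sys_output S xbar0 (unstack m ubar)) 0 (L - 1) | ubar xbar0.
               ubar \<in> carrier_vec (m * L) \<and> xbar0 \<in> carrier_vec n}"
    using fundamental_lemma[OF L _ u pe x0] S by blast
next
  fix K A B C D :: "real mat" and x0 :: "real vec" and d
  assume pe: "K_persistently_exciting K m (L + n) N u"
    and S: "(A, B, C, D) \<in> controllable_systems n m p"
    and x0: "x0 \<in> carrier_vec n" and d: "annihilating_coeffs n A d"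
  have "A \<in> carrier_mat n n" "B \<in> carrier_mat n m"
    using S by (auto simp: controllable_systems_def)
  thus "let H = hankel n 1 (N + 1 - L) (sys_state A B x0 u) @\<^sub>r hankel m L N u;
                 Z = Z_mat n m L A B d
             in loewner_ge (n + m * L) (H * H\<^sup>T) ((1 / (real n + 1)) \<cdot>\<^sub>m (Z * K * Z\<^sup>T))"
    unfolding Let_def using u by (intro quantitative_fundamental_lemma[OF L _ _ _ pe x0 d]) auto
qed

end
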